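(* Every involution semigroup of order four (that is, with exactly four elements) is finitely based.
   Context: An involution semigroup $(S,{}^* )$ is a semigroup $S$ with a unary operation ${}^*$ satisfying the identities $(x^* )^*\approx x$ and $(xy)^*\approx y^*x^*$. Identities of involution semigroups are expressions $\mathbf u\approx\mathbf v$ in the language with one binary operation (multiplication) and one unary operation ${}^*$; $(S,{}^* )$ satisfies $\mathbf u\approx\mathbf v$ if both sides take the same value under every substitution of elements of $S$ for the variables. An identity basis for $(S,{}^* )$ is a set $\Sigma$ of identities of $(S,{}^* )$ from which every identity satisfied by $(S,{}^* )$ is deducible (associativity and the two involution axioms may be taken for granted). $(S,{}^* )$ is finitely based if it has some finite identity basis. *)

theory Defs
  imports Main
begin

locale involution_semigroup =
  fixes S :: "'a set"
    and mult :: "'a \<Rightarrow> 'a \<Rightarrow> 'a"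
    and star :: "'a \<Rightarrow> 'a"
  assumes mult_closed: "x \<in> S \<Longrightarrow> y \<in> S \<Longrightarrow> mult x y \<in> S"
    and star_closed: "x \<in> S \<Longrightarrow> star x \<in> S"
    and mult_assoc: "x \<in> S \<Longrightarrow> y \<in> S \<Longrightarrow> z \<in> S \<Longrightarrow> mult (mult x y) z = mult x (mult y z)"
    and star_star: "x \<in> S \<Longrightarrow> star (star x) = x"
    and star_mult: "x \<in> S \<Longrightarrow> y \<in> S \<Longrightarrow> star (mult x y) = mult (star y) (star x)"

text \<open>Words are absolutely free terms over a countably infinite alphabet;
  associativity and the involution laws are added as axioms of deduction below.\<close>

datatype iterm = Var nat | Mult iterm iterm | Star iterm

type_synonym identity = "iterm \<times> iterm"

primrec subst :: "(nat \<Rightarrow> iterm) \<Rightarrow> iterm \<Rightarrow> iterm" where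
  "subst \<sigma> (Var i) = \<sigma> i"
| "subst \<sigma> (Mult u v) = Mult (subst \<sigma> u) (subst \<sigma> v)"
| "subst \<sigma> (Star u) = Star (subst \<sigma> u)"

primrec value_of :: "('a \<Rightarrow> 'a \<Rightarrow> 'a) \<Rightarrow> ('a \<Rightarrow> 'a) \<Rightarrow> (nat \<Rightarrow> 'a) \<Rightarrow> iterm \<Rightarrow> 'a" where
  "value_of mult star \<phi> (Var i) = \<phi> i"
| "value_of mult star \<phi> (Mult u v) = mult (value_of mult star \<phi> u) (value_of mult star \<phi> v)"
| "value_of mult star \<phi> (Star u) = star (value_of mult star \<phi> u)"

definition satisfies :: "'a set \<Rightarrow> ('a \<Rightarrow> 'a \<Rightarrow> 'a) \<Rightarrow> ('a \<Rightarrow> 'a) \<Rightarrow> identity \<Rightarrow> bool" where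
  "satisfies S mult star e \<longleftrightarrow>
    (\<forall>\<phi>. (\<forall>i. \<phi> i \<in> S) \<longrightarrow> value_of mult star \<phi> (fst e) = value_of mult star \<phi> (snd e))"

text \<open>Birkhoff's rules of equational logic.\<close>

inductive deducible :: "identity set \<Rightarrow> iterm \<Rightarrow> iterm \<Rightarrow> bool" for \<Sigma> :: "identity set" where
  inst: "(u, v) \<in> \<Sigma> \<Longrightarrow> deducible \<Sigma> (subst \<sigma> u) (subst \<sigma> v)"
| refl: "deducible \<Sigma> u u"
| sym: "deducible \<Sigma> u v \<Longrightarrow> deducible \<Sigma> v u"
| trans: "deducible \<Sigma> u v \<Longrightarrow> deducible \<Sigma> v w \<Longrightarrow> deducible \<Sigma> u w"
| mult_cong: "deducible \<Sigma> u u' \<Longrightarrow> deducible \<Sigma> v v' \<Longrightarrow> deducible \<Sigma> (Mult u v) (Mult u' v')"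
| star_cong: "deducible \<Sigma> u v \<Longrightarrow> deducible \<Sigma> (Star u) (Star v)"

definition involution_axioms :: "identity set" where
  "involution_axioms =
    {(Mult (Mult (Var 0) (Var 1)) (Var 2), Mult (Var 0) (Mult (Var 1) (Var 2))),
     (Star (Star (Var 0)), Var 0),
     (Star (Mult (Var 0) (Var 1)), Mult (Star (Var 1)) (Star (Var 0)))}"

definition identity_basis ::
  "'a set \<Rightarrow> ('a \<Rightarrow> 'a \<Rightarrow> 'a) \<Rightarrow> ('a \<Rightarrow> 'a) \<Rightarrow> identity set \<Rightarrow> bool" where
  "identity_basis S mult star \<Sigma> \<longleftrightarrow>
    (\<forall>e\<in>\<Sigma>. satisfies S mult star e) \<and>
    (\<forall>u v. satisfies S mult star (u, v) \<longrightarrow> deducible (involution_axioms \<union> \<Sigma>) u v)"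

definition finitely_based :: "'a set \<Rightarrow> ('a \<Rightarrow> 'a \<Rightarrow> 'a) \<Rightarrow> ('a \<Rightarrow> 'a) \<Rightarrow> bool" where
  "finitely_based S mult star \<longleftrightarrow> (\<exists>\<Sigma>. finite \<Sigma> \<and> identity_basis S mult star \<Sigma>)"

end

theory Submission
  imports Defs "HOL-Library.FuncSet"
begin

text \<open>
  An involution semigroup of order four is either commutative or one of six noncommutative ones.
  In both cases terms are first flattened to words: the involution laws push every star down to the
  variables, so an identity amounts to a pair of nonempty words in letters \<open>x\<close> and \<open>x\<^sup>*\<close>.

  Finite commutative involution semigroups of any order are finitely based
  (\<open>finite_commutative_finitely_based\<close>). Modulo \<open>xy = yx\<close> and a law \<open>x^(m+p) = x^m\<close>, an identity is
  determined, up to renaming variables, by the number of variables that have each of the finitely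
  many possible profiles, the profile of \<open>x\<close> being the list of reduced exponents of \<open>x\<close> and \<open>x\<^sup>*\<close> on
  the two sides. Replacing \<open>x\<close> by a product of new variables replaces it by several variables of the
  same profile, because powers of commuting products distribute. Hence an identity entails every
  identity obtained from it by increasing nonzero multiplicities, and Dickson's lemma leaves
  finitely many minimal identities.

  If the multiplication is not commutative, then the star is not the identity map, since otherwise
  \<open>xy = (xy)\<^sup>* = y\<^sup>*x\<^sup>* = yx\<close>; and as every \<open>xx\<^sup>*\<close> is fixed by the star, it swaps two elements and fixes
  the other two. A finite search leaves six multiplication tables up to relabelling
  (\<open>noncommutative_table_exhaust\<close>). For each of them a basis is formed by the valid
  identities between words of length at most six in six variables; a rewriting rule that is short
  enough then only has to be verified in the semigroup, and the work lies in showing that rules of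
  this size suffice. This is done by normal forms.

  \<^item> In the rectangular band and in the two nilpotent semigroups, every word equals one with at most
    three letters.
  \<^item> In the semigroup of \<open>side\<close> elements, a word with at least two letters is determined by its set of
    variables together with its first and its last letter, as far as their variables occur only once.
  \<^item> The two triangular semigroups consist of \<open>e\<close>, \<open>f\<close>, \<open>c\<close>, \<open>0\<close> with \<open>e\<close> and \<open>f\<close> idempotent, swapped by
    the star, \<open>fe = 0\<close>, \<open>ec = c = cf\<close>, and \<open>ef\<close> either \<open>c\<close> or \<open>0\<close>. A product is nonzero only if it
    reads \<open>e\<dots>e\<close>, then at most one \<open>c\<close>, then \<open>f\<dots>f\<close>. So the nonzero evaluations of a word are the
    places where it can be cut into an \<open>e\<close>-part and an \<open>f\<close>-part consistently, and these places form a
    chain. Accordingly each word is rewritten to \<open>0\<close> or to \<open>L B\<^sub>1 \<dots> B\<^sub>k L\<^sup>*\<close>, where the word \<open>L\<close> matters only as a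
    set, the \<open>B\<^sub>i\<close> are disjoint blocks that cannot be cut, and each block is either a single letter
    or a square that again matters only as a set (\<open>chain_cases\<close>). The evaluations recover
    \<open>L\<close> and the order and kind of the blocks, up to reversing the core when \<open>L\<close> is nonempty
    (\<open>reduced_unique\<close>).
\<close>

section \<open>Terms as words\<close>

text \<open>A letter is a variable together with a flag that tells whether it carries a
  star.\<close>
type_synonym letter = "nat \<times> bool"
type_synonym word = "letter list"

definition flip :: "letter \<Rightarrow> letter" where
  "flip l = (fst l, \<not> snd l)"

definition inv_word :: "word \<Rightarrow> word" where
  "inv_word w = rev (map flip w)"

lemma flip_pair: "flip (n, b) = (n, \<not> b)"
  by (simp add: flip_def)

lemma flip_simps [simp]: "flip (flip l) = l" "fst (flip l) = fst l"
  "flip l \<noteq> l" "l \<noteq> flip l" "flip l = flip k \<longleftrightarrow> l = k"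
  by (cases l; cases k; auto simp: flip_def)+

lemma same_variable: "fst x = fst y \<Longrightarrow> x = y \<or> x = flip y"
  by (cases x; cases y) (auto simp: flip_pair)

lemma flip_in_image [simp]: "flip l \<in> flip ` A \<longleftrightarrow> l \<in> A"
  by (auto simp: image_iff)

lemma in_flip_image: "l \<in> flip ` A \<longleftrightarrow> flip l \<in> A"
  using flip_in_image[of "flip l" A] by simp

lemma inv_word_simps [simp]: "inv_word [] = []" "inv_word (u @ v) = inv_word v @ inv_word u"
  "inv_word (l # u) = inv_word u @ [flip l]" "inv_word (inv_word u) = u"
  "set (inv_word u) = flip ` set u" "length (inv_word u) = length u"
  "inv_word u = [] \<longleftrightarrow> u = []"
  by (auto simp: inv_word_def rev_map comp_def)

primrec letter_term :: "letter \<Rightarrow> iterm" where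
  "letter_term (n, b) = (if b then Star (Var n) else Var n)"

text \<open>The value at the empty word is a placeholder; only nonempty words stand for
  terms.\<close>
fun term_of :: "word \<Rightarrow> iterm" where
  "term_of [] = Var 0"
| "term_of [l] = letter_term l"
| "term_of (l # k # w) = Mult (letter_term l) (term_of (k # w))"

lemma term_of_Cons: "w \<noteq> [] \<Longrightarrow> term_of (l # w) = Mult (letter_term l) (term_of w)"
  by (cases w) auto

primrec word_of :: "iterm \<Rightarrow> word" where
  "word_of (Var i) = [(i, False)]"
| "word_of (Mult s t) = word_of s @ word_of t"
| "word_of (Star t) = inv_word (word_of t)"

lemma word_of_nonempty [simp]: "word_of t \<noteq> []"
  by (induction t) auto

definition derivable :: "identity set \<Rightarrow> iterm \<Rightarrow> iterm \<Rightarrow> bool" where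
  "derivable \<Sigma> = deducible (involution_axioms \<union> \<Sigma>)"

lemma derivable_refl [simp]: "derivable \<Sigma> t t"
  and derivable_sym: "derivable \<Sigma> s t \<Longrightarrow> derivable \<Sigma> t s"
  and derivable_trans [trans]: "derivable \<Sigma> s t \<Longrightarrow> derivable \<Sigma> t r \<Longrightarrow> derivable \<Sigma> s r"
  and derivable_Mult: "derivable \<Sigma> s s' \<Longrightarrow> derivable \<Sigma> t t' \<Longrightarrow> derivable \<Sigma> (Mult s t) (Mult s' t')"
  and derivable_Star: "derivable \<Sigma> s t \<Longrightarrow> derivable \<Sigma> (Star s) (Star t)"
  and derivable_inst: "(s, t) \<in> \<Sigma> \<Longrightarrow> derivable \<Sigma> (subst \<sigma> s) (subst \<sigma> t)"
  unfolding derivable_def by (auto intro: deducible.intros)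

lemma derivable_assoc: "derivable \<Sigma> (Mult (Mult r s) t) (Mult r (Mult s t))"
proof -
  define \<sigma> where "\<sigma> = (\<lambda>i::nat. if i = 0 then r else if i = 1 then s else t)"
  show ?thesis
    using deducible.inst[of "Mult (Mult (Var 0) (Var 1)) (Var 2)" "Mult (Var 0) (Mult (Var 1) (Var 2))"
        "involution_axioms \<union> \<Sigma>" \<sigma>]
    by (simp add: derivable_def involution_axioms_def \<sigma>_def)
qed

lemma derivable_Star_Star: "derivable \<Sigma> (Star (Star t)) t"
  using deducible.inst[of "Star (Star (Var 0))" "Var 0" "involution_axioms \<union> \<Sigma>" "\<lambda>_. t"]
  by (simp add: derivable_def involution_axioms_def)

lemma derivable_Star_Mult: "derivable \<Sigma> (Star (Mult s t)) (Mult (Star t) (Star s))"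
  using deducible.inst[of "Star (Mult (Var 0) (Var 1))" "Mult (Star (Var 1)) (Star (Var 0))"
      "involution_axioms \<union> \<Sigma>" "\<lambda>i. if i = 0 then s else t"]
  by (simp add: derivable_def involution_axioms_def)

lemma derivable_append:
  "u \<noteq> [] \<Longrightarrow> v \<noteq> [] \<Longrightarrow> derivable \<Sigma> (Mult (term_of u) (term_of v)) (term_of (u @ v))"
proof (induction u rule: term_of.induct)
  case (2 l)
  then show ?case by (simp add: term_of_Cons)
next
  case (3 l k w)
  have "derivable \<Sigma> (Mult (term_of (l # k # w)) (term_of v))
      (Mult (letter_term l) (Mult (term_of (k # w)) (term_of v)))"
    by (simp add: derivable_assoc)
  also have "derivable \<Sigma> \<dots> (Mult (letter_term l) (term_of ((k # w) @ v)))"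
    using 3 by (intro derivable_Mult) auto
  finally show ?case by simp
qed simp

lemma derivable_Star_letter: "derivable \<Sigma> (Star (letter_term l)) (letter_term (flip l))"
  by (cases l) (auto simp: flip_pair derivable_Star_Star)

lemma derivable_inv_word: "u \<noteq> [] \<Longrightarrow> derivable \<Sigma> (Star (term_of u)) (term_of (inv_word u))"
proof (induction u rule: term_of.induct)
  case (2 l)
  then show ?case by (simp add: derivable_Star_letter)
next
  case (3 l k w)
  have "derivable \<Sigma> (Star (term_of (l # k # w))) (Mult (Star (term_of (k # w))) (Star (letter_term l)))"
    by (simp add: derivable_Star_Mult)
  also have "derivable \<Sigma> \<dots> (Mult (term_of (inv_word (k # w))) (term_of [flip l]))"
    using 3 derivable_Star_letter by (intro derivable_Mult) auto
  also have "derivable \<Sigma> \<dots> (term_of (inv_word (k # w) @ [flip l]))"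
    by (intro derivable_append) auto
  finally show ?case by simp
qed simp

text \<open>Associativity and the involution laws alone flatten every term.\<close>
lemma derivable_word_of: "derivable \<Sigma> t (term_of (word_of t))"
proof (induction t)
  case (Mult s t)
  show ?case
    using derivable_trans[OF derivable_Mult[OF Mult] derivable_append] by simp
next
  case (Star t)
  show ?case
    using derivable_trans[OF derivable_Star[OF Star] derivable_inv_word] by simp
qed auto

text \<open>The first conjunct separates the empty word from the letter that shares its placeholder
  term. With it, the relation is a congruence on all lists, so that contexts and parameters of
  later rules may be empty.\<close>
definition weq :: "identity set \<Rightarrow> word \<Rightarrow> word \<Rightarrow> bool" where
  "weq \<Sigma> u v \<longleftrightarrow> (u = [] \<longleftrightarrow> v = []) \<and> derivable \<Sigma> (term_of u) (term_of v)"

lemma weq_refl [simp]: "weq \<Sigma> u u"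
  and weq_sym: "weq \<Sigma> u v \<Longrightarrow> weq \<Sigma> v u"
  and weq_trans [trans]: "weq \<Sigma> u v \<Longrightarrow> weq \<Sigma> v w \<Longrightarrow> weq \<Sigma> u w"
  unfolding weq_def by (auto intro: derivable_sym derivable_trans)

lemma weq_append:
  assumes "weq \<Sigma> u u'" and "weq \<Sigma> v v'"
  shows "weq \<Sigma> (u @ v) (u' @ v')"
proof (cases "u = [] \<or> v = []")
  case False
  then have "derivable \<Sigma> (term_of (u @ v)) (Mult (term_of u) (term_of v))"
    by (intro derivable_sym[OF derivable_append]) auto
  also have "derivable \<Sigma> \<dots> (Mult (term_of u') (term_of v'))"
    using assms by (intro derivable_Mult) (auto simp: weq_def)
  also have "derivable \<Sigma> \<dots> (term_of (u' @ v'))"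
    using assms False by (intro derivable_append) (auto simp: weq_def)
  finally show ?thesis using assms False by (auto simp: weq_def)
qed (use assms in \<open>auto simp: weq_def\<close>)

lemma weq_context: "weq \<Sigma> u v \<Longrightarrow> weq \<Sigma> (p @ u @ q) (p @ v @ q)"
  by (intro weq_append weq_refl)

lemma weq_step: "weq \<Sigma> u v \<Longrightarrow> x = p @ u @ q \<Longrightarrow> y = p @ v @ q \<Longrightarrow> weq \<Sigma> x y"
  by (simp add: weq_context)

definition letter_subst :: "(nat \<Rightarrow> word) \<Rightarrow> letter \<Rightarrow> word" where
  "letter_subst \<sigma> l = (if snd l then inv_word (\<sigma> (fst l)) else \<sigma> (fst l))"

definition word_subst :: "(nat \<Rightarrow> word) \<Rightarrow> word \<Rightarrow> word" where
  "word_subst \<sigma> w = concat (map (letter_subst \<sigma>) w)"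

lemma word_subst_simps [simp]: "word_subst \<sigma> [] = []"
  "word_subst \<sigma> (l # w) = letter_subst \<sigma> l @ word_subst \<sigma> w"
  "word_subst \<sigma> (u @ v) = word_subst \<sigma> u @ word_subst \<sigma> v"
  by (auto simp: word_subst_def)

lemma letter_subst_simps [simp]: "letter_subst \<sigma> (n, False) = \<sigma> n"
  "letter_subst \<sigma> (n, True) = inv_word (\<sigma> n)"
  by (auto simp: letter_subst_def)

lemma derivable_word_subst:
  assumes ne: "\<And>n. \<sigma> n \<noteq> []" and "w \<noteq> []"
  shows "derivable \<Sigma> (subst (\<lambda>n. term_of (\<sigma> n)) (term_of w)) (term_of (word_subst \<sigma> w))"
  using assms(2)
proof (induction w rule: term_of.induct)
  case (2 l)
  then show ?case using ne by (cases l) (auto simp: derivable_inv_word)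
next
  case (3 l k w)
  have *: "derivable \<Sigma> (subst (\<lambda>n. term_of (\<sigma> n)) (letter_term l)) (term_of (letter_subst \<sigma> l))"
    using ne by (cases l) (auto simp: derivable_inv_word)
  have ne': "letter_subst \<sigma> l \<noteq> []" for l using ne by (auto simp: letter_subst_def)
  have "derivable \<Sigma> (subst (\<lambda>n. term_of (\<sigma> n)) (term_of (l # k # w)))
      (Mult (term_of (letter_subst \<sigma> l)) (term_of (word_subst \<sigma> (k # w))))"
    using 3 * derivable_Mult by auto
  also have "derivable \<Sigma> \<dots> (term_of (letter_subst \<sigma> l @ word_subst \<sigma> (k # w)))"
    using ne' by (intro derivable_append) auto
  finally show ?case by simp
qed simp

lemma word_subst_nonempty: "(\<And>n. \<sigma> n \<noteq> []) \<Longrightarrow> w \<noteq> [] \<Longrightarrow> word_subst \<sigma> w \<noteq> []"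
  by (cases w) (auto simp: letter_subst_def)

definition word_identities :: "(word \<times> word) set \<Rightarrow> identity set" where
  "word_identities R = (\<lambda>(u, v). (term_of u, term_of v)) ` R"

text \<open>Substituted words must be nonempty because the empty word does not denote a term. Rules
  with a parameter that may be empty therefore need one instance for each case.\<close>
lemma weq_inst:
  assumes "(u, v) \<in> R" and "u \<noteq> []" and "v \<noteq> []" and ne: "\<And>n. \<sigma> n \<noteq> []"
  shows "weq (word_identities R) (word_subst \<sigma> u) (word_subst \<sigma> v)"
proof -
  let ?S = "word_identities R" and ?s = "\<lambda>n. term_of (\<sigma> n)"
  have "derivable ?S (term_of (word_subst \<sigma> u)) (subst ?s (term_of u))"
    using assms by (intro derivable_sym[OF derivable_word_subst]) auto
  also have "derivable ?S \<dots> (subst ?s (term_of v))"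
    using assms(1) by (intro derivable_inst) (auto simp: word_identities_def)
  also have "derivable ?S \<dots> (term_of (word_subst \<sigma> v))"
    using assms by (intro derivable_word_subst) auto
  finally show ?thesis using assms word_subst_nonempty by (simp add: weq_def)
qed

definition holds :: "'a set \<Rightarrow> ('a \<Rightarrow> 'a \<Rightarrow> 'a) \<Rightarrow> ('a \<Rightarrow> 'a) \<Rightarrow> word \<Rightarrow> word \<Rightarrow> bool" where
  "holds S mult star u v \<longleftrightarrow> u \<noteq> [] \<and> v \<noteq> [] \<and> satisfies S mult star (term_of u, term_of v)"

context involution_semigroup
begin

lemma value_of_closed: "(\<And>i. \<phi> i \<in> S) \<Longrightarrow> value_of mult star \<phi> t \<in> S"
  by (induction t) (auto intro: mult_closed star_closed)

lemma value_of_subst: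
  "value_of mult star \<phi> (subst \<sigma> t) = value_of mult star (\<lambda>i. value_of mult star \<phi> (\<sigma> i)) t"
  by (induction t) auto

lemma satisfies_involution_axioms: "e \<in> involution_axioms \<Longrightarrow> satisfies S mult star e"
  by (auto simp: involution_axioms_def satisfies_def mult_assoc star_star star_mult)

lemma derivable_sound:
  assumes "\<And>e. e \<in> \<Sigma> \<Longrightarrow> satisfies S mult star e" and "derivable \<Sigma> s t"
  shows "satisfies S mult star (s, t)"
proof -
  have "deducible (involution_axioms \<union> \<Sigma>) s t" using assms(2) by (simp add: derivable_def)
  then show ?thesis
  proof (induction rule: deducible.induct)
    case (inst u v \<sigma>)
    then have "satisfies S mult star (u, v)" using assms(1) satisfies_involution_axioms by blast
    then show ?case using value_of_closed by (auto simp: satisfies_def value_of_subst)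
  qed (auto simp: satisfies_def)
qed

lemma satisfies_word_of:
  assumes "satisfies S mult star (s, t)"
  shows "holds S mult star (word_of s) (word_of t)"
proof -
  have "value_of mult star \<phi> (term_of (word_of t)) = value_of mult star \<phi> t" if "\<And>i. \<phi> i \<in> S" for \<phi> t
    using derivable_sound[OF _ derivable_word_of, of "{}" t] that by (simp add: satisfies_def)
  then show ?thesis using assms by (simp add: holds_def satisfies_def)
qed

text \<open>Flattening reduces the search for a basis to identities between words: the identity of
  two terms is derivable from the one of their words.\<close>
lemma finitely_based_words:
  assumes "finite R" and "\<And>u v. (u, v) \<in> R \<Longrightarrow> holds S mult star u v"
    and complete: "\<And>u v. holds S mult star u v \<Longrightarrow> weq (word_identities R) u v"
  shows "finitely_based S mult star"
  unfolding finitely_based_def identity_basis_def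
proof (intro exI[of _ "word_identities R"] conjI ballI allI impI)
  show "finite (word_identities R)" using assms(1) by (simp add: word_identities_def)
next
  fix e assume "e \<in> word_identities R"
  then show "satisfies S mult star e" using assms(2) by (auto simp: word_identities_def holds_def)
next
  fix s t assume "satisfies S mult star (s, t)"
  then have "weq (word_identities R) (word_of s) (word_of t)"
    by (intro complete satisfies_word_of)
  then have "derivable (word_identities R) s t"
    by (meson derivable_sym derivable_trans derivable_word_of weq_def)
  then show "deducible (involution_axioms \<union> word_identities R) s t"
    by (simp add: derivable_def)
qed

end

text \<open>A finite set of valid identities that serves as a basis for every noncommutative
  semigroup below. The bound six leaves room for each rewriting rule, and for the distinct
  variables in a pair of words of length three.\<close>
definition short_laws :: "'a set \<Rightarrow> ('a \<Rightarrow> 'a \<Rightarrow> 'a) \<Rightarrow> ('a \<Rightarrow> 'a) \<Rightarrow> (word \<times> word) set" where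
  "short_laws S mult star = {(u, v). holds S mult star u v \<and> length u \<le> 6 \<and> length v \<le> 6 \<and>
     fst ` set (u @ v) \<subseteq> {..<6}}"

lemma finite_short_laws: "finite (short_laws S mult star)"
proof -
  let ?W = "{u. set u \<subseteq> {..<6::nat} \<times> (UNIV :: bool set) \<and> length u \<le> 6}"
  have "finite ?W" by (intro finite_lists_length_le) auto
  then have "finite (?W \<times> ?W)" by blast
  moreover have "short_laws S mult star \<subseteq> ?W \<times> ?W"
    by (fastforce simp: short_laws_def)
  ultimately show ?thesis by (rule rev_finite_subset)
qed

abbreviation short_weq :: "'a set \<Rightarrow> ('a \<Rightarrow> 'a \<Rightarrow> 'a) \<Rightarrow> ('a \<Rightarrow> 'a) \<Rightarrow> word \<Rightarrow> word \<Rightarrow> bool" where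
  "short_weq S mult star \<equiv> weq (word_identities (short_laws S mult star))"

lemma short_weq_inst:
  assumes "holds S mult star u v" and "length u \<le> 6" and "length v \<le> 6"
    and "fst ` set (u @ v) \<subseteq> {..<6}" and "\<And>n. \<sigma> n \<noteq> []"
  shows "short_weq S mult star (word_subst \<sigma> u) (word_subst \<sigma> v)"
  using assms by (intro weq_inst) (auto simp: short_laws_def holds_def)

context involution_semigroup
begin

lemma finitely_based_short:
  assumes "\<And>u v. holds S mult star u v \<Longrightarrow> short_weq S mult star u v"
  shows "finitely_based S mult star"
  using assms by (intro finitely_based_words[OF finite_short_laws]) (auto simp: short_laws_def)

lemma short_weq_sound:
  assumes "short_weq S mult star u v" and "u \<noteq> []"
  shows "holds S mult star u v"
proof -
  have "satisfies S mult star (term_of u, term_of v)"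
    using assms(1) by (intro derivable_sound[of "word_identities (short_laws S mult star)"])
      (auto simp: word_identities_def short_laws_def holds_def weq_def)
  then show ?thesis using assms by (auto simp: holds_def weq_def)
qed

end

text \<open>Assignments and substitutions for identities in at most four variables.\<close>
definition pick :: "'b \<Rightarrow> 'b \<Rightarrow> 'b \<Rightarrow> 'b \<Rightarrow> nat \<Rightarrow> 'b" where
  "pick x y z t n = (if n = 0 then x else if n = 1 then y else if n = 2 then z else t)"

text \<open>Turns an identity that is checked on the finitely many values of four variables into a
  rewriting rule for words.\<close>
lemma short_law:
  assumes law: "\<forall>a b c d. value_of mult star (pick a b c d) (term_of u) =
      value_of mult star (pick a b c d) (term_of v)"
    and size: "u \<noteq> []" "v \<noteq> []" "length u \<le> 6" "length v \<le> 6" "fst ` set (u @ v) \<subseteq> {..<4}"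
    and "x \<noteq> []" "y \<noteq> []" "z \<noteq> []" "t \<noteq> []"
  shows "short_weq UNIV mult star (word_subst (pick x y z t) u) (word_subst (pick x y z t) v)"
proof (rule short_weq_inst)
  have restrict: "value_of mult star \<phi> (term_of w) =
      value_of mult star (pick (\<phi> 0) (\<phi> 1) (\<phi> 2) (\<phi> 3)) (term_of w)"
    if "w \<noteq> []" "fst ` set w \<subseteq> {..<4}" for \<phi> w
    using that
  proof (induction w rule: term_of.induct)
    case (2 l)
    then have "fst l \<in> {0, 1, 2, 3}" by auto
    then show ?case by (cases l) (auto simp: pick_def)
  next
    case (3 l k w)
    then have "fst l \<in> {0, 1, 2, 3}" by auto
    then show ?case using 3 by (cases l) (auto simp: pick_def)
  qed simp
  have "value_of mult star \<phi> (term_of u) = value_of mult star \<phi> (term_of v)" for \<phi>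
    using size law by (subst (1 2) restrict) auto
  then show "holds UNIV mult star u v"
    using size by (simp add: holds_def satisfies_def)
qed (use assms in \<open>auto simp: pick_def\<close>)

definition lval :: "('a \<Rightarrow> 'a) \<Rightarrow> (nat \<Rightarrow> 'a) \<Rightarrow> letter \<Rightarrow> 'a" where
  "lval star \<phi> l = (if snd l then star (\<phi> (fst l)) else \<phi> (fst l))"

definition wval :: "('a \<Rightarrow> 'a \<Rightarrow> 'a) \<Rightarrow> ('a \<Rightarrow> 'a) \<Rightarrow> (nat \<Rightarrow> 'a) \<Rightarrow> word \<Rightarrow> 'a" where
  "wval mult star \<phi> w = value_of mult star \<phi> (term_of w)"

lemma wval_letter [simp]: "wval mult star \<phi> [l] = lval star \<phi> l"
  by (cases l) (auto simp: wval_def lval_def)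

lemma wval_Cons: "w \<noteq> [] \<Longrightarrow> wval mult star \<phi> (l # w) = mult (lval star \<phi> l) (wval mult star \<phi> w)"
  by (cases l) (auto simp: wval_def lval_def term_of_Cons)

lemma wval_cong:
  assumes "w \<noteq> []" and "\<And>n. n \<in> fst ` set w \<Longrightarrow> \<phi> n = \<psi> n"
  shows "wval mult star \<phi> w = wval mult star \<psi> w"
  using assms
proof (induction w rule: list_nonempty_induct)
  case (cons l w)
  then show ?case by (simp add: wval_Cons lval_def)
qed (simp add: lval_def)

lemma holds_wval:
  "holds S mult star u v \<longleftrightarrow> u \<noteq> [] \<and> v \<noteq> [] \<and>
    (\<forall>\<phi>. (\<forall>i. \<phi> i \<in> S) \<longrightarrow> wval mult star \<phi> u = wval mult star \<phi> v)"
  by (simp add: holds_def satisfies_def wval_def)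

section \<open>Finite commutative involution semigroups\<close>

text \<open>Dickson's lemma for the order in which \<open>b\<close> lies below \<open>a\<close> if
  \<open>b \<le> a\<close> pointwise on \<open>Q\<close> and both vanish at the same points of
  \<open>Q\<close>. For a new coordinate \<open>q\<close>, take a finite basis \<open>P\<close> of
  the members of \<open>A\<close> that are positive at \<open>q\<close>. Members with a large value
  at \<open>q\<close> lie above an element of \<open>P\<close>, and each of the finitely many small
  values at \<open>q\<close> gets a finite basis of its own.\<close>
lemma dickson:
  fixes A :: "('q \<Rightarrow> nat) set"
  assumes "finite Q"
  shows "\<exists>B\<subseteq>A. finite B \<and> (\<forall>a\<in>A. \<exists>b\<in>B. \<forall>q\<in>Q. b q \<le> a q \<and> (b q = 0 \<longrightarrow> a q = 0))"
  using assms
proof (induction Q arbitrary: A)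
  case empty
  show ?case
  proof (cases "A = {}")
    case False
    then obtain a where "a \<in> A" by blast
    then show ?thesis by (intro exI[of _ "{a}"]) auto
  qed auto
next
  case (insert q Q)
  let ?dom = "\<lambda>b a. \<forall>q\<in>Q. b q \<le> a q \<and> (b q = 0 \<longrightarrow> a q = 0)"
  obtain P where P: "P \<subseteq> {a \<in> A. a q > 0}" "finite P" "\<forall>a\<in>{a \<in> A. a q > 0}. \<exists>b\<in>P. ?dom b a"
    using insert.IH[of "{a \<in> A. a q > 0}"] by blast
  obtain N where N: "\<And>b. b \<in> P \<Longrightarrow> b q \<le> N"
    using P(2) finite_nat_set_iff_bounded_le[of "(\<lambda>b. b q) ` P"] by blast
  have "\<forall>i. \<exists>B\<subseteq>{a \<in> A. a q = i}. finite B \<and> (\<forall>a\<in>{a \<in> A. a q = i}. \<exists>b\<in>B. ?dom b a)"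
    using insert.IH by blast
  from choice[OF this] obtain B where B': "\<forall>i. B i \<subseteq> {a \<in> A. a q = i} \<and> finite (B i) \<and>
    (\<forall>a\<in>{a \<in> A. a q = i}. \<exists>b\<in>B i. ?dom b a)" ..
  then have B: "\<And>i. B i \<subseteq> {a \<in> A. a q = i}" "\<And>i. finite (B i)"
    "\<And>i a. a \<in> A \<Longrightarrow> a q = i \<Longrightarrow> \<exists>b\<in>B i. ?dom b a" by simp_all
  show ?case
  proof (intro exI[of _ "P \<union> (\<Union>i\<le>N. B i)"] conjI ballI)
    show "P \<union> (\<Union>i\<le>N. B i) \<subseteq> A" using P(1) B(1) by blast
    show "finite (P \<union> (\<Union>i\<le>N. B i))" using P(2) B(2) by blast
    fix a assume a: "a \<in> A"
    show "\<exists>b\<in>P \<union> (\<Union>i\<le>N. B i). \<forall>q\<in>insert q Q. b q \<le> a q \<and> (b q = 0 \<longrightarrow> a q = 0)"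
    proof (cases "a q \<le> N")
      case True
      obtain b where "b \<in> B (a q)" "?dom b a" using B(3)[OF a] by blast
      moreover have "b q = a q" using B(1) \<open>b \<in> B (a q)\<close> by blast
      ultimately show ?thesis using True by (intro bexI[of _ b]) auto
    next
      case False
      then obtain b where b: "b \<in> P" "?dom b a" using P(3) a by fastforce
      moreover have "b q \<le> a q" "b q > 0" using False N[OF b(1)] P(1) b(1) by auto
      ultimately show ?thesis by (intro bexI[of _ b]) auto
    qed
  qed
qed

lemma surjection_of_card_le:
  assumes "finite X" and "finite Y" and "card Y \<le> card X" and "Y = {} \<Longrightarrow> X = {}"
  shows "\<exists>g. g ` X = Y"
proof (cases "Y = {}")
  case True
  then show ?thesis using assms(4) by auto
next
  case False
  then obtain y where y: "y \<in> Y" by blast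
  obtain f where f: "inj_on f Y" "f ` Y \<subseteq> X" using card_le_inj[OF assms(2,1,3)] by blast
  let ?g = "\<lambda>x. if x \<in> f ` Y then inv_into Y f x else y"
  have "?g ` X = Y"
  proof
    show "?g ` X \<subseteq> Y" using y by (auto intro: inv_into_into)
    show "Y \<subseteq> ?g ` X"
    proof
      fix z assume z: "z \<in> Y"
      then have "?g (f z) = z" using f(1) by simp
      moreover have "f z \<in> X" using z f(2) by blast
      ultimately show "z \<in> ?g ` X" by (rule image_eqI[OF HOL.sym])
    qed
  qed
  then show ?thesis by blast
qed

text \<open>The exponent that represents \<open>n\<close> modulo the law \<open>x^(m+p) =
  x^m\<close>.\<close>
definition reduce :: "nat \<Rightarrow> nat \<Rightarrow> nat \<Rightarrow> nat" where
  "reduce m p n = (if n < m + p then n else m + (n - m) mod p)"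

lemma reduce_less: "p > 0 \<Longrightarrow> reduce m p n < m + p"
  by (simp add: reduce_def)

lemma reduce_0 [simp]: "m > 0 \<Longrightarrow> reduce m p n = 0 \<longleftrightarrow> n = 0"
  by (auto simp: reduce_def)

lemma reduce_minus:
  assumes "n \<ge> m + p"
  shows "reduce m p (n - p) = reduce m p n"
proof -
  have "(n - m) mod p = (n - p - m) mod p"
    using assms mod_add_self2[of "n - p - m" p] by (simp add: algebra_simps)
  then show ?thesis using assms by (auto simp: reduce_def)
qed

locale commutative_words =
  fixes R :: "(word \<times> word) set" and m p :: nat
  assumes commute_mem: "([(0, False), (1, False)], [(1, False), (0, False)]) \<in> R"
    and power_mem: "(replicate (m + p) (0, False), replicate m (0, False)) \<in> R"
    and pos: "m > 0" "p > 0"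
begin

abbreviation ceq (infix "\<approx>" 50) where
  "u \<approx> v \<equiv> weq (word_identities R) u v"

lemma ceq_commute: "u @ v \<approx> v @ u"
proof (cases "u = [] \<or> v = []")
  case False
  then show ?thesis
    using weq_inst[OF commute_mem, of "\<lambda>n. if n = 0 then u else v"] by auto
qed auto

lemma ceq_perm: "(\<And>l. count_list u l = count_list v l) \<Longrightarrow> u \<approx> v"
proof (induction u arbitrary: v)
  case (Cons x u)
  then have "x \<in> set v" by (metis count_list_0_iff list.set_intros(1))
  then obtain p q where v: "v = p @ x # q" using split_list by metis
  have "u \<approx> p @ q"
  proof (rule Cons.IH)
    show "count_list u l = count_list (p @ q) l" for l
      using Cons.prems[of l] by (simp add: v split: if_splits)
  qed
  then have "x # u \<approx> [x] @ p @ q" using weq_append[of _ "[x]" "[x]" u] by simp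
  also have "\<dots> \<approx> v" using weq_append[OF ceq_commute[of "[x]" p] weq_refl[of _ q]] by (simp add: v)
  finally show ?case .
next
  case Nil
  then have "x \<notin> set v" for x by (simp add: count_list_0_iff[symmetric])
  then have "v = []" by (cases v) auto
  then show ?case by simp
qed

lemma ceq_period: "replicate (m + p) l \<approx> replicate m l"
proof -
  have "word_subst (\<lambda>_. [l]) (replicate n (0, False)) = replicate n l" for n
    by (induction n) auto
  then show ?thesis using weq_inst[OF power_mem, of "\<lambda>_. [l]"] pos by simp
qed

lemma ceq_reduce: "replicate n l \<approx> replicate (reduce m p n) l"
proof (induction n rule: less_induct)
  case (less n)
  show ?case
  proof (cases "n < m + p")
    case False
    then have n: "n = (m + p) + (n - (m + p))" by simp
    have "replicate n l = replicate (m + p) l @ replicate (n - (m + p)) l"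
      by (subst n, subst replicate_add) simp
    also have "\<dots> \<approx> replicate m l @ replicate (n - (m + p)) l"
      by (intro weq_append ceq_period weq_refl)
    also have "\<dots> = replicate (n - p) l"
      unfolding replicate_add[symmetric] using False by (intro arg_cong2[of _ _ _ _ replicate]) auto
    also have "\<dots> \<approx> replicate (reduce m p (n - p)) l" using False pos by (intro less) auto
    finally show ?thesis using False reduce_minus[of m p n] by simp
  qed (simp add: reduce_def)
qed

definition sorted_word :: "(letter \<Rightarrow> nat) \<Rightarrow> letter list \<Rightarrow> word" where
  "sorted_word f ls = concat (map (\<lambda>l. replicate (f l) l) ls)"

lemma count_sorted_word:
  "distinct ls \<Longrightarrow> count_list (sorted_word f ls) l = (if l \<in> set ls then f l else 0)"
proof -
  have "count_list (replicate n k) l = (if k = l then n else 0)" for n and k :: letter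
    by (induction n) auto
  then show "distinct ls \<Longrightarrow> count_list (sorted_word f ls) l = (if l \<in> set ls then f l else 0)"
    by (induction ls) (auto simp: sorted_word_def)
qed

lemma ceq_sorted_word: "sorted_word f ls \<approx> sorted_word (\<lambda>l. reduce m p (f l)) ls"
  by (induction ls) (auto simp: sorted_word_def intro: weq_append ceq_reduce)

text \<open>Both words can be sorted along a common list of letters, after which the powers of each
  letter are reduced separately.\<close>
lemma ceq_exponents:
  assumes "\<And>l. reduce m p (count_list u l) = reduce m p (count_list v l)"
  shows "u \<approx> v"
proof -
  obtain ls where ls: "distinct ls" "set ls = set (u @ v)"
    using finite_distinct_list[of "set (u @ v)"] by auto
  have sorted: "w \<approx> sorted_word (\<lambda>l. reduce m p (count_list w l)) ls" if "set w \<subseteq> set ls" for w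
  proof -
    have "count_list w l = count_list (sorted_word (count_list w) ls) l" for l
      using that ls(1) by (auto simp: count_sorted_word count_list_0_iff)
    from weq_trans[OF ceq_perm[OF this] ceq_sorted_word] show ?thesis .
  qed
  have "u \<approx> sorted_word (\<lambda>l. reduce m p (count_list v l)) ls" using sorted[of u] ls(2) assms by simp
  then show ?thesis using sorted[of v] ls(2) by (auto intro: weq_trans weq_sym)
qed

end

text \<open>The reduced exponents of \<open>x\<close> and \<open>x\<^sup>*\<close> in the left
  word, followed by those in the right word.\<close>
type_synonym profile = "(nat \<times> nat) \<times> (nat \<times> nat)"

definition profile :: "nat \<Rightarrow> nat \<Rightarrow> word \<times> word \<Rightarrow> nat \<Rightarrow> profile" where
  "profile m p e n = (let r = (\<lambda>w. (reduce m p (count_list w (n, False)), reduce m p (count_list w (n, True))))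
     in (r (fst e), r (snd e)))"

text \<open>For the profile \<open>absent\<close> below the class of variables is infinite and this
  number carries no information; all other profiles occur only at the finitely many variables of
  the identity.\<close>
definition multiplicity :: "nat \<Rightarrow> nat \<Rightarrow> word \<times> word \<Rightarrow> profile \<Rightarrow> nat" where
  "multiplicity m p e q = card {n. profile m p e n = q}"

abbreviation absent :: profile where
  "absent \<equiv> ((0, 0), (0, 0))"

lemma profile_absent_iff:
  assumes "m > 0"
  shows "profile m p (u, v) n = absent \<longleftrightarrow> n \<notin> fst ` set (u @ v)"
proof -
  have "n \<in> fst ` set w \<longleftrightarrow> (n, False) \<in> set w \<or> (n, True) \<in> set w" for w :: word
  proof
    assume "n \<in> fst ` set w"
    then obtain b where "(n, b) \<in> set w" by auto
    then show "(n, False) \<in> set w \<or> (n, True) \<in> set w" by (cases b) auto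
  qed (auto intro: rev_image_eqI)
  then show ?thesis using assms by (auto simp: profile_def Let_def count_list_0_iff image_Un)
qed

lemma finite_profile_class: "m > 0 \<Longrightarrow> q \<noteq> absent \<Longrightarrow> finite {n. profile m p (u, v) n = q}"
  by (rule finite_subset[of _ "fst ` set (u @ v)"]) (use profile_absent_iff in blast)+

lemma profile_bounded: "p > 0 \<Longrightarrow> profile m p e n \<in> ({..<m+p} \<times> {..<m+p}) \<times> ({..<m+p} \<times> {..<m+p})"
  by (simp add: profile_def Let_def reduce_less)

context commutative_words
begin

text \<open>The key step of the commutative case. Under the hypothesis on multiplicities, the
  variables of \<open>u = v\<close> map onto those of \<open>u' = v'\<close> in a way that
  preserves profiles. Substituting for each variable of \<open>u' = v'\<close> the product of its
  preimages turns \<open>u' = v'\<close> into an identity with the same reduced exponents as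
  \<open>u = v\<close>.\<close>
lemma spread_variables:
  assumes mem: "(u', v') \<in> R" and ne: "u' \<noteq> []" "v' \<noteq> []"
    and dom: "\<And>q. q \<noteq> absent \<Longrightarrow> multiplicity m p (u', v') q \<le> multiplicity m p (u, v) q \<and>
      (multiplicity m p (u', v') q = 0 \<longrightarrow> multiplicity m p (u, v) q = 0)"
  shows "u \<approx> v"
proof -
  let ?ty = "profile m p (u, v)" and ?ty' = "profile m p (u', v')"
  have "\<exists>g. g ` {n. ?ty n = q} = {n. ?ty' n = q}" if "q \<noteq> absent" for q
    using dom[OF that] finite_profile_class[OF pos(1) that]
    by (intro surjection_of_card_le) (auto simp: multiplicity_def)
  then obtain G where G: "\<And>q. q \<noteq> absent \<Longrightarrow> G q ` {n. ?ty n = q} = {n. ?ty' n = q}" by metis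
  define g where "g n = G (?ty n) n" for n
  have g_ty: "?ty' (g n) = ?ty n" if "?ty n \<noteq> absent" for n
    using G[OF that] by (auto simp: g_def)
  define X where "X n' = {n. ?ty n \<noteq> absent \<and> g n = n'}" for n'
  have X_fin: "finite (X n')" for n'
    by (rule finite_subset[of _ "fst ` set (u @ v)"]) (auto simp: X_def profile_absent_iff[OF pos(1)])
  have X_ne: "X n' \<noteq> {}" if "?ty' n' \<noteq> absent" for n'
  proof -
    have "n' \<in> G (?ty' n') ` {n. ?ty n = ?ty' n'}" using G[OF that] by simp
    then obtain n where "?ty n = ?ty' n'" "n' = G (?ty' n') n" by auto
    then have "n \<in> X n'" using that by (simp add: X_def g_def)
    then show ?thesis by blast
  qed
  \<comment> \<open>The product of the preimages; the default letter keeps the substitution nonempty elsewhere.\<close>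
  define \<sigma> where "\<sigma> n' = (if X n' = {} then [(0, False)]
    else map (\<lambda>n. (n, False)) (sorted_list_of_set (X n')))" for n'
  have \<sigma>_ne: "\<sigma> n' \<noteq> []" for n' using X_fin by (auto simp: \<sigma>_def)
  have count_\<sigma>: "count_list (\<sigma> n') (n, b) = (if \<not> b \<and> n \<in> X n' then 1 else 0)" if "X n' \<noteq> {}" for n' n b
  proof -
    have "distinct (\<sigma> n')" using that by (simp add: \<sigma>_def distinct_map inj_on_def)
    moreover have "set (\<sigma> n') = (\<lambda>n. (n, False)) ` X n'" using that X_fin by (simp add: \<sigma>_def)
    moreover have "count_list xs x = (if x \<in> set xs then 1 else 0)" if "distinct xs" for xs and x :: letter
      using that by (induction xs) auto
    ultimately show ?thesis by auto
  qed
  have count_inv: "count_list (inv_word w) (n, b) = count_list w (n, \<not> b)" for w n b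
    by (induction w) (auto simp: flip_def)
  have count_letter: "count_list (letter_subst \<sigma> l) (n, b) = (if ?ty n \<noteq> absent \<and> l = (g n, b) then 1 else 0)"
    if "?ty' (fst l) \<noteq> absent" for l n b
  proof -
    have "count_list (letter_subst \<sigma> l) (n, b) = count_list (\<sigma> (fst l)) (n, b \<noteq> snd l)"
      by (simp add: letter_subst_def count_inv)
    also have "\<dots> = (if \<not> (b \<noteq> snd l) \<and> n \<in> X (fst l) then 1 else 0)"
      by (rule count_\<sigma>[OF X_ne[OF that]])
    also have "\<dots> = (if ?ty n \<noteq> absent \<and> l = (g n, b) then 1 else 0)"
      by (cases l) (auto simp: X_def)
    finally show ?thesis .
  qed
  have count_word: "count_list (word_subst \<sigma> w) (n, b) = (if ?ty n \<noteq> absent then count_list w (g n, b) else 0)"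
    if "\<forall>l\<in>set w. ?ty' (fst l) \<noteq> absent" for w n b
    using that by (induction w) (auto simp: count_letter)
  have present: "\<forall>l\<in>set w. ?ty' (fst l) \<noteq> absent" if "w \<in> {u', v'}" for w
    using that by (auto simp: profile_absent_iff[OF pos(1)])
  have "word_subst \<sigma> u' \<approx> u"
  proof (rule ceq_exponents)
    fix l :: letter
    obtain n b where l: "l = (n, b)" by (cases l)
    show "reduce m p (count_list (word_subst \<sigma> u') l) = reduce m p (count_list u l)"
      unfolding l count_word[OF present[of u', simplified]]
      using g_ty[of n] pos by (cases b; cases "?ty n = absent") (auto simp: profile_def Let_def)
  qed
  moreover have "word_subst \<sigma> v' \<approx> v"
  proof (rule ceq_exponents)
    fix l :: letter
    obtain n b where l: "l = (n, b)" by (cases l)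
    show "reduce m p (count_list (word_subst \<sigma> v') l) = reduce m p (count_list v l)"
      unfolding l count_word[OF present[of v', simplified]]
      using g_ty[of n] pos by (cases b; cases "?ty n = absent") (auto simp: profile_def Let_def)
  qed
  moreover have "word_subst \<sigma> u' \<approx> word_subst \<sigma> v'"
    using weq_inst[OF mem ne] \<sigma>_ne by blast
  ultimately show ?thesis by (meson weq_sym weq_trans)
qed

end

context involution_semigroup
begin

text \<open>There are only finitely many maps from \<open>S\<close> to itself, so two power maps
  with positive exponents coincide.\<close>
lemma finite_periodic:
  assumes "finite S"
  shows "\<exists>m p. m > 0 \<and> p > 0 \<and> holds S mult star (replicate (m + p) (0, False)) (replicate m (0, False))"
proof -
  define g where "g n = (\<lambda>x\<in>S. wval mult star (\<lambda>_. x) (replicate n (0, False)))" for n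
  have "g n \<in> S \<rightarrow>\<^sub>E S" for n
    using value_of_closed by (auto simp: g_def wval_def)
  then have "g ` {1..} \<subseteq> S \<rightarrow>\<^sub>E S" by blast
  then have "finite (g ` {1..})" using finite_PiE[OF assms, of "\<lambda>_. S"] assms finite_subset by blast
  then have "\<not> inj_on g {1..}" using finite_imageD infinite_Ici by blast
  then obtain i j where ij: "i \<ge> 1" "i < j" "g i = g j"
    by (metis atLeast_iff inj_on_def linorder_neqE_nat)
  have eq: "wval mult star \<phi> (replicate n (0, False)) = g n (\<phi> 0)" if "\<phi> 0 \<in> S" "n \<ge> 1" for \<phi> n
  proof -
    have "wval mult star \<phi> (replicate n (0, False)) = wval mult star (\<lambda>_. \<phi> 0) (replicate n (0, False))"
      using that by (intro wval_cong) auto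
    then show ?thesis using that by (simp add: g_def)
  qed
  have "holds S mult star (replicate (i + (j - i)) (0, False)) (replicate i (0, False))"
    using ij eq[of _ i] eq[of _ j] by (auto simp: holds_wval)
  then show ?thesis using ij by (intro exI[of _ i] exI[of _ "j - i"]) auto
qed

text \<open>The basis consists of commutativity, periodicity and the finitely many valid identities
  whose multiplicities are minimal in the sense of Dickson's lemma. Profiles outside the finite set
  \<open>?Q\<close> do not occur, so the comparison on \<open>?Q\<close> is a comparison at every
  profile other than \<open>absent\<close>.\<close>
theorem finite_commutative_finitely_based:
  assumes fin: "finite S" and comm: "\<And>x y. x \<in> S \<Longrightarrow> y \<in> S \<Longrightarrow> mult x y = mult y x"
  shows "finitely_based S mult star"
proof -
  obtain m p where mp: "m > 0" "p > 0"
    "holds S mult star (replicate (m + p) (0, False)) (replicate m (0, False))"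
    using finite_periodic[OF fin] by blast
  let ?Q = "({..<m+p} \<times> {..<m+p}) \<times> ({..<m+p} \<times> {..<m+p}) - {absent}"
  let ?H = "{(u, v). holds S mult star u v}"
  obtain B where B: "B \<subseteq> multiplicity m p ` ?H" "finite B"
    "\<forall>a\<in>multiplicity m p ` ?H. \<exists>b\<in>B. \<forall>q\<in>?Q. b q \<le> a q \<and> (b q = 0 \<longrightarrow> a q = 0)"
    using dickson[of ?Q "multiplicity m p ` ?H"] by auto
  obtain R0 where R0: "R0 \<subseteq> ?H" "finite R0" "B = multiplicity m p ` R0"
    using finite_subset_image[OF B(2,1)] by blast
  define R where "R = insert ([(0, False), (1, False)], [(1, False), (0, False)])
    (insert (replicate (m + p) (0, False), replicate m (0, False)) R0)"
  interpret commutative_words R m p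
    using mp by unfold_locales (auto simp: R_def)
  show ?thesis
  proof (rule finitely_based_words)
    show "finite R" using R0(2) by (simp add: R_def)
    have "holds S mult star [(0, False), (1, False)] [(1, False), (0, False)]"
      using comm by (simp add: holds_def satisfies_def)
    then show "holds S mult star u v" if "(u, v) \<in> R" for u v
      using that R0(1) mp(3) by (auto simp: R_def)
    fix u v assume uv: "holds S mult star u v"
    then obtain u' v' where e: "(u', v') \<in> R0"
      and dom: "\<forall>q\<in>?Q. multiplicity m p (u', v') q \<le> multiplicity m p (u, v) q \<and>
        (multiplicity m p (u', v') q = 0 \<longrightarrow> multiplicity m p (u, v) q = 0)"
      using B(3) R0(3) by fastforce
    have zero: "multiplicity m p e q = 0" if "q \<notin> ?Q" "q \<noteq> absent" for e q
    proof -
      have "{n. profile m p e n = q} = {}" using that profile_bounded[OF mp(2)] by blast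
      then show ?thesis by (simp add: multiplicity_def)
    qed
    show "weq (word_identities R) u v"
    proof (rule spread_variables)
      show "(u', v') \<in> R" "u' \<noteq> []" "v' \<noteq> []" using e R0(1) by (auto simp: R_def holds_def)
      show "multiplicity m p (u', v') q \<le> multiplicity m p (u, v) q \<and>
        (multiplicity m p (u', v') q = 0 \<longrightarrow> multiplicity m p (u, v) q = 0)" if "q \<noteq> absent" for q
      proof (cases "q \<in> ?Q")
        case True
        from bspec[OF dom this] show ?thesis .
      next
        case False
        from zero[OF this that] show ?thesis by simp
      qed
    qed
  qed
qed

end

section \<open>Semigroups in which long words collapse\<close>

definition rename_letter :: "(nat \<Rightarrow> nat) \<Rightarrow> letter \<Rightarrow> letter" where
  "rename_letter g l = (g (fst l), snd l)"

abbreviation rename :: "(nat \<Rightarrow> nat) \<Rightarrow> word \<Rightarrow> word" where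
  "rename g \<equiv> map (rename_letter g)"

lemma long_word: "\<not> length w \<le> 3 \<Longrightarrow> \<exists>a b r. w = a # b # r \<and> r \<noteq> []"
  by (cases w; cases "tl w"; cases "tl (tl w)") auto

context involution_semigroup
begin

lemma holds_rename:
  assumes "holds S mult star u v"
  shows "holds S mult star (rename g u) (rename g v)"
proof -
  have "value_of mult star \<phi> (term_of (rename g w)) = value_of mult star (\<phi> \<circ> g) (term_of w)"
    if "w \<noteq> []" for \<phi> w
  proof -
    have "wval mult star \<phi> (rename g w) = wval mult star (\<phi> \<circ> g) w"
      using that by (induction w rule: list_nonempty_induct) (auto simp: wval_Cons lval_def rename_letter_def)
    then show ?thesis by (simp add: wval_def)
  qed
  then show ?thesis using assms by (auto simp: holds_def satisfies_def)
qed

text \<open>Two words of length three contain at most six variables, which can be renamed to the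
  first six.\<close>
lemma short_weq_of_length_le:
  assumes "holds S mult star u v" and len: "length u \<le> 3" "length v \<le> 3"
  shows "short_weq S mult star u v"
proof -
  let ?V = "fst ` set (u @ v)"
  have "card ?V \<le> card (set (u @ v))" by (intro card_image_le) simp
  also have "\<dots> \<le> length (u @ v)" by (rule card_length)
  finally have "card ?V \<le> card {..<6::nat}" using len by simp
  then obtain g where g: "g ` ?V \<subseteq> {..<6::nat}" "inj_on g ?V"
    using card_le_inj[of ?V "{..<6::nat}"] by auto
  define \<sigma> where "\<sigma> k = [(inv_into ?V g k, False)]" for k
  have undo: "word_subst \<sigma> (rename g w) = w" if "set w \<subseteq> set (u @ v)" for w
    using that
  proof (induction w)
    case (Cons l w)
    then have "inv_into ?V g (g (fst l)) = fst l" using g(2) by (intro inv_into_f_f) auto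
    then have "letter_subst \<sigma> (rename_letter g l) = [l]"
      by (cases l) (auto simp: \<sigma>_def letter_subst_def flip_pair rename_letter_def)
    then show ?case using Cons by simp
  qed simp
  have "short_weq S mult star (word_subst \<sigma> (rename g u)) (word_subst \<sigma> (rename g v))"
  proof (rule short_weq_inst)
    show "fst ` set (rename g u @ rename g v) \<subseteq> {..<6}"
      using g(1) by (simp add: image_Un image_image rename_letter_def)
  qed (use holds_rename[OF assms(1)] len in \<open>auto simp: \<sigma>_def\<close>)
  then show ?thesis by (simp add: undo)
qed

lemma finitely_based_of_length_bound:
  assumes bound: "\<And>w. w \<noteq> [] \<Longrightarrow> \<exists>w'. short_weq S mult star w w' \<and> length w' \<le> 3"
  shows "finitely_based S mult star"
proof (rule finitely_based_short)
  fix u v assume uv: "holds S mult star u v"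
  then have ne: "u \<noteq> []" "v \<noteq> []" by (auto simp: holds_def)
  obtain u' where u': "short_weq S mult star u u'" "length u' \<le> 3" using bound[OF ne(1)] by blast
  obtain v' where v': "short_weq S mult star v v'" "length v' \<le> 3" using bound[OF ne(2)] by blast
  have "holds S mult star u' v'"
    using uv short_weq_sound[OF u'(1) ne(1)] short_weq_sound[OF v'(1) ne(2)]
    by (simp add: holds_def satisfies_def)
  then have "short_weq S mult star u' v'" using u'(2) v'(2) by (rule short_weq_of_length_le)
  then show "short_weq S mult star u v" using u'(1) v'(1) by (meson weq_sym weq_trans)
qed

lemma finitely_based_rectangular:
  assumes "\<And>x y z. x \<in> S \<Longrightarrow> y \<in> S \<Longrightarrow> z \<in> S \<Longrightarrow> mult x (mult y z) = mult x z"
  shows "finitely_based S mult star"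
proof (rule finitely_based_of_length_bound)
  fix w :: word assume "w \<noteq> []"
  then show "\<exists>w'. short_weq S mult star w w' \<and> length w' \<le> 3"
  proof (induction w rule: length_induct)
    case (1 w)
    show ?case
    proof (cases "length w \<le> 3")
      case True
      then show ?thesis by (intro exI[of _ w]) simp
    next
      case False
      then obtain a b r where w: "w = a # b # r" "r \<noteq> []" using long_word by fastforce
      have "holds S mult star [(0, False), (1, False), (2, False)] [(0, False), (2, False)]"
        using assms by (simp add: holds_def satisfies_def)
      from short_weq_inst[OF this, of "pick [a] [b] r r"] have "short_weq S mult star w (a # r)"
        using w by (auto simp: pick_def)
      moreover obtain w' where "short_weq S mult star (a # r) w'" "length w' \<le> 3"
        using 1 w by (metis length_Cons lessI list.discI)
      ultimately show ?thesis using weq_trans by blast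
    qed
  qed
qed

lemma finitely_based_nilpotent:
  assumes "\<And>x y z x' y' z'. {x, y, z, x', y', z'} \<subseteq> S \<Longrightarrow> mult x (mult y z) = mult x' (mult y' z')"
  shows "finitely_based S mult star"
proof (rule finitely_based_of_length_bound)
  fix w :: word
  show "\<exists>w'. short_weq S mult star w w' \<and> length w' \<le> 3"
  proof (cases "length w \<le> 3")
    case True
    then show ?thesis by (intro exI[of _ w]) simp
  next
    case False
    then obtain a b r where w: "w = a # b # r" "r \<noteq> []" using long_word by fastforce
    have "holds S mult star [(0, False), (1, False), (2, False)] [(3, False), (3, False), (3, False)]"
      using assms by (simp add: holds_def satisfies_def)
    from short_weq_inst[OF this, of "pick [a] [b] r [a]"] have "short_weq S mult star w [a, a, a]"
      using w by (auto simp: pick_def)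
    then show ?thesis by (intro exI[of _ "[a, a, a]"]) simp
  qed
qed

end

text \<open>Isomorphic copies satisfy the same identities, so a basis can be computed in a concrete
  model.\<close>
lemma finitely_based_iso:
  fixes h :: "'b \<Rightarrow> 'a" and mult :: "'a \<Rightarrow> 'a \<Rightarrow> 'a" and m :: "'b \<Rightarrow> 'b \<Rightarrow> 'b"
  assumes bij: "bij_betw h UNIV S" and mult: "\<And>x y. h (m x y) = mult (h x) (h y)"
    and star: "\<And>x. h (st x) = star (h x)" and fb: "finitely_based UNIV m st"
  shows "finitely_based S mult star"
proof -
  have val: "value_of mult star (h \<circ> \<phi>) t = h (value_of m st \<phi> t)" for \<phi> t
    by (induction t) (auto simp: mult star)
  have inj: "inj h" and surj: "range h = S" using bij by (auto simp: bij_betw_def)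
  have "satisfies S mult star e \<longleftrightarrow> satisfies UNIV m st e" for e
  proof
    assume S: "satisfies S mult star e"
    show "satisfies UNIV m st e"
      unfolding satisfies_def
    proof (intro allI impI)
      fix \<phi> :: "nat \<Rightarrow> 'b"
      have "value_of mult star (h \<circ> \<phi>) (fst e) = value_of mult star (h \<circ> \<phi>) (snd e)"
        using S surj unfolding satisfies_def by auto
      then show "value_of m st \<phi> (fst e) = value_of m st \<phi> (snd e)"
        using inj by (simp add: val inj_eq)
    qed
  next
    assume U: "satisfies UNIV m st e"
    show "satisfies S mult star e"
      unfolding satisfies_def
    proof (intro allI impI)
      fix \<phi> :: "nat \<Rightarrow> 'a" assume "\<forall>i. \<phi> i \<in> S"
      then have "\<phi> = h \<circ> (inv h \<circ> \<phi>)" using surj by (auto simp: fun_eq_iff f_inv_into_f)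
      then show "value_of mult star \<phi> (fst e) = value_of mult star \<phi> (snd e)"
        using U val unfolding satisfies_def by (metis UNIV_I)
    qed
  qed
  then show ?thesis using fb by (simp add: finitely_based_def identity_basis_def)
qed


section \<open>The semigroup with one-sided identities\<close>

text \<open>The idempotent \<open>Id\<close> is a right identity for \<open>Lt\<close> and a left
  identity for \<open>Rt\<close>; all other products are the zero \<open>Nl\<close>. The star
  exchanges \<open>Lt\<close> and \<open>Rt\<close>. A product of at least two factors is nonzero
  only if all factors are \<open>Id\<close>, apart from a first factor \<open>Lt\<close> or else a
  last factor \<open>Rt\<close>.\<close>
datatype side = Lt | Rt | Id | Nl

fun smul :: "side \<Rightarrow> side \<Rightarrow> side" where
  "smul Lt Id = Lt"
| "smul Id Rt = Rt"
| "smul Id Id = Id"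
| "smul _ _ = Nl"

fun sstar :: "side \<Rightarrow> side" where
  "sstar Lt = Rt"
| "sstar Rt = Lt"
| "sstar Id = Id"
| "sstar Nl = Nl"

lemma smul_assoc: "smul (smul x y) z = smul x (smul y z)"
  by (cases x; cases y; cases z) auto

interpretation side: involution_semigroup UNIV smul sstar
proof
  fix x y :: side
  show "sstar (sstar x) = x" by (cases x) auto
  show "sstar (smul x y) = smul (sstar y) (sstar x)" by (cases x; cases y) auto
qed (auto simp: smul_assoc)

abbreviation seq :: "word \<Rightarrow> word \<Rightarrow> bool" where
  "seq \<equiv> short_weq UNIV smul sstar"

lemma all_side: "(\<forall>x. P x) \<longleftrightarrow> P Lt \<and> P Rt \<and> P Id \<and> P Nl"
  by (metis side.exhaust)

lemmas check_side = all_side pick_def flip_pair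

text \<open>An inner factor of a nonzero product is \<open>Id\<close>, so inside a word stars,
  repetitions and order are irrelevant. A first or last letter whose variable recurs elsewhere must
  also be \<open>Id\<close>; the remaining rules copy such a letter into the middle and exchange it
  for any other letter that occurs there.\<close>
lemma middle_star:
  assumes "x \<noteq> []" and "y \<noteq> []" and "z \<noteq> []"
  shows "seq (x @ y @ z) (x @ inv_word y @ z)"
  using short_law[of smul sstar "[(0, False), (1, False), (2, False)]" "[(0, False), (1, True), (2, False)]" x y z x] assms
    by (simp add: check_side)

lemma middle_square:
  assumes "x \<noteq> []" and "y \<noteq> []" and "z \<noteq> []"
  shows "seq (x @ y @ z) (x @ y @ y @ z)"
  using short_law[of smul sstar "[(0, False), (1, False), (2, False)]" "[(0, False), (1, False), (1, False), (2, False)]" x y z x] assms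
    by (simp add: check_side)

lemma middle_swap:
  assumes "x \<noteq> []" and "y \<noteq> []" and "z \<noteq> []" and "t \<noteq> []"
  shows "seq (x @ y @ z @ t) (x @ z @ y @ t)"
  using short_law[of smul sstar "[(0, False), (1, False), (2, False), (3, False)]" "[(0, False), (2, False), (1, False), (3, False)]" x y z t] assms
    by (simp add: check_side)

lemma change_head:
  assumes "x \<noteq> []" and "y \<noteq> []" and "z \<noteq> []"
  shows "seq (x @ x @ y @ z) (y @ x @ y @ z)"
  using short_law[of smul sstar "[(0, False), (0, False), (1, False), (2, False)]" "[(1, False), (0, False), (1, False), (2, False)]" x y z x] assms
    by (simp add: check_side)

lemma change_last:
  assumes "z \<noteq> []" and "y \<noteq> []" and "x \<noteq> []"
  shows "seq (z @ y @ x @ x) (z @ y @ x @ y)"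
  using short_law[of smul sstar "[(0, False), (1, False), (2, False), (2, False)]" "[(0, False), (1, False), (2, False), (1, False)]" z y x z] assms
    by (simp add: check_side)

lemma saturate_same:
  assumes "x \<noteq> []"
  shows "seq (x @ y @ x) (x @ x @ y @ x)"
proof (cases "y = []")
  case True
  then show ?thesis
    using short_law[of smul sstar "[(0, False), (0, False)]" "[(0, False), (0, False), (0, False)]" x x x x] assms
    by (simp add: check_side)
next
  case False
  then show ?thesis
    using short_law[of smul sstar "[(0, False), (1, False), (0, False)]" "[(0, False), (0, False), (1, False), (0, False)]" x y x x] assms
    by (simp add: check_side)
qed

lemma saturate_flip:
  assumes "x \<noteq> []"
  shows "seq (x @ y @ inv_word x) (x @ x @ y @ inv_word x)"
proof (cases "y = []")
  case True
  then show ?thesis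
    using short_law[of smul sstar "[(0, False), (0, True)]" "[(0, False), (0, False), (0, True)]" x x x x] assms
    by (simp add: check_side)
next
  case False
  then show ?thesis
    using short_law[of smul sstar "[(0, False), (1, False), (0, True)]" "[(0, False), (0, False), (1, False), (0, True)]" x y x x] assms
    by (simp add: check_side)
qed


abbreviation vars :: "word \<Rightarrow> nat set" where
  "vars w \<equiv> fst ` set w"

lemma middle_insert:
  assumes "h \<noteq> []" and "l \<noteq> []" and "fst a \<in> vars m"
  shows "seq (h @ m @ l) (h @ a # m @ l)"
proof -
  obtain b where b: "b \<in> set m" "fst a = fst b" using assms(3) by auto
  obtain u v where m: "m = u @ b # v" using split_list[OF b(1)] by blast
  have front: "seq (h @ m @ l) (h @ [b] @ u @ v @ l)"
  proof (cases "u = []")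
    case False
    then show ?thesis
      using middle_swap[of h u "[b]" "v @ l"] assms by (simp add: m)
  qed (simp add: m)
  have "seq (h @ [b] @ u @ v @ l) (h @ [b, b] @ u @ v @ l)"
    using middle_square[of h "[b]" "u @ v @ l"] assms by simp
  also have "seq \<dots> (h @ [a, b] @ u @ v @ l)"
    using same_variable[OF b(2)] middle_star[of h "[b]" "b # u @ v @ l"] assms by auto
  also have "seq \<dots> (h @ [a] @ m @ l)"
  proof (cases "u = []")
    case False
    then show ?thesis
      using middle_swap[of "h @ [a]" "[b]" u "v @ l"] assms by (simp add: m)
  qed (simp add: m)
  finally show ?thesis using weq_trans[OF front] by simp
qed

lemma middle_absorb:
  assumes "h \<noteq> []" and "l \<noteq> []" and "vars p \<subseteq> vars m"
  shows "seq (h @ m @ l) (h @ p @ m @ l)"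
  using assms(3)
proof (induction p)
  case (Cons a p)
  then have "seq (h @ m @ l) (h @ p @ m @ l)" by simp
  also have "seq \<dots> (h @ (a # p) @ m @ l)"
    using Cons middle_insert[of h l a "p @ m"] assms by auto
  finally show ?case .
qed simp

text \<open>A copy of the second middle is inserted in front of the first one, and then the two
  change places.\<close>
lemma middle_cong:
  assumes "h \<noteq> []" and "l \<noteq> []" and "vars m = vars m'"
  shows "seq (h @ m @ l) (h @ m' @ l)"
proof (cases "m = [] \<or> m' = []")
  case True
  then show ?thesis using assms(3) by auto
next
  case False
  have "seq (h @ m @ l) (h @ m' @ m @ l)" using assms by (intro middle_absorb) auto
  also have "seq \<dots> (h @ m @ m' @ l)" using assms False by (intro middle_swap) auto
  also have "seq \<dots> (h @ m' @ l)" using assms by (intro weq_sym[OF middle_absorb]) auto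
  finally show ?thesis .
qed

lemma head_cong:
  assumes "fst h \<in> vars m" and "fst h' \<in> vars m"
  shows "seq (h # m @ [l]) (h' # m @ [l])"
proof -
  have ne: "m \<noteq> []" using assms by auto
  \<comment> \<open>Copies of both letters next to the first position bring the word into the form of the rule.\<close>
  have ins: "vars m = vars ([h, h'] @ m)" using assms by auto
  have "seq (h # m @ [l]) (h # ([h, h'] @ m) @ [l])" using middle_cong[OF _ _ ins, of "[h]" "[l]"] by simp
  also have "seq \<dots> (h' # ([h, h'] @ m) @ [l])"
    using change_head[of "[h]" "[h']" "m @ [l]"] by simp
  also have "seq \<dots> (h' # m @ [l])" using middle_cong[OF _ _ ins[symmetric], of "[h']" "[l]"] by simp
  finally show ?thesis .
qed

lemma last_cong:
  assumes "fst l \<in> vars m" and "fst l' \<in> vars m"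
  shows "seq (h # m @ [l]) (h # m @ [l'])"
proof -
  have ins: "vars m = vars (m @ [l', l])" using assms by auto
  have "seq (h # m @ [l]) (h # (m @ [l', l]) @ [l])" using middle_cong[OF _ _ ins, of "[h]" "[l]"] by simp
  also have "seq \<dots> (h # (m @ [l', l]) @ [l'])"
    using change_last[of "h # m" "[l']" "[l]"] by simp
  also have "seq \<dots> (h # m @ [l'])" using middle_cong[OF _ _ ins[symmetric], of "[h]" "[l']"] by simp
  finally show ?thesis .
qed

abbreviation sev :: "(nat \<Rightarrow> side) \<Rightarrow> word \<Rightarrow> side" where
  "sev \<equiv> wval smul sstar"

abbreviation sval :: "(nat \<Rightarrow> side) \<Rightarrow> letter \<Rightarrow> side" where
  "sval \<equiv> lval sstar"

lemma smul_eq: "smul a b = Id \<longleftrightarrow> a = Id \<and> b = Id" "smul a b = Lt \<longleftrightarrow> a = Lt \<and> b = Id"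
  "smul a b = Rt \<longleftrightarrow> a = Id \<and> b = Rt"
  by (cases a; cases b; simp)+

lemma sev_Id: "w \<noteq> [] \<Longrightarrow> sev \<phi> w = Id \<longleftrightarrow> (\<forall>x\<in>set w. sval \<phi> x = Id)"
  by (induction w rule: list_nonempty_induct) (auto simp: wval_Cons smul_eq)

lemma sev_Lt: "sev \<phi> (h # w) = Lt \<longleftrightarrow> sval \<phi> h = Lt \<and> (\<forall>x\<in>set w. sval \<phi> x = Id)"
  by (cases "w = []") (auto simp: wval_Cons smul_eq sev_Id)

lemma sev_Rt: "sev \<phi> (w @ [l]) = Rt \<longleftrightarrow> sval \<phi> l = Rt \<and> (\<forall>x\<in>set w. sval \<phi> x = Id)"
  by (induction w) (auto simp: wval_Cons smul_eq)

text \<open>With the value \<open>Lt\<close> for \<open>a\<close> this assignment tests whether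
  \<open>x\<close> is a first letter whose variable does not recur; with \<open>Rt\<close> it tests
  the same for a last letter.\<close>
definition spike :: "letter \<Rightarrow> side \<Rightarrow> nat \<Rightarrow> side" where
  "spike x a n = (if n = fst x then (if snd x then sstar a else a) else Id)"

lemma sval_spike: "sval (spike x a) y = (if y = x then a else if y = flip x then sstar a else Id)"
  by (cases x; cases y; cases a) (auto simp: spike_def lval_def flip_pair)

lemma sval_spike_Id: "a \<in> {Lt, Rt} \<Longrightarrow> sval (spike x a) y = Id \<longleftrightarrow> fst y \<noteq> fst x"
  using same_variable[of y x] by (auto simp: sval_spike)

lemma sval_spike_Lt: "sval (spike x Lt) y = Lt \<longleftrightarrow> y = x"
  and sval_spike_Rt: "sval (spike x Rt) y = Rt \<longleftrightarrow> y = x"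
  by (auto simp: sval_spike)

lemma side_agree_vars:
  assumes "u \<noteq> []" "v \<noteq> []" and agree: "\<And>\<phi>. sev \<phi> u = sev \<phi> v"
  shows "vars v \<subseteq> vars u"
proof
  fix n assume "n \<in> vars v"
  then obtain x where x: "x \<in> set v" "n = fst x" by blast
  let ?\<phi> = "\<lambda>n. if n \<in> vars u then Id else Nl"
  have "sev ?\<phi> u = Id" using assms(1) by (subst sev_Id) (auto simp: lval_def)
  then have "\<forall>x\<in>set v. sval ?\<phi> x = Id" using agree sev_Id[OF assms(2)] by metis
  then have "sval ?\<phi> x = Id" using x by blast
  then show "n \<in> vars u" by (simp add: lval_def x(2) split: if_splits)
qed

lemma simple_head_determined:
  assumes "sev (spike h Lt) (h # w) = sev (spike h Lt) (h' # w')" and "fst h \<notin> vars w"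
  shows "h' = h \<and> fst h \<notin> vars w'"
proof -
  have "fst y \<noteq> fst h" if "y \<in> set w" for y using assms(2) that by (metis image_eqI)
  then have "sev (spike h Lt) (h # w) = Lt" by (auto simp: sev_Lt sval_spike_Lt sval_spike_Id)
  then show ?thesis using assms(1) by (auto simp: sev_Lt sval_spike_Lt sval_spike_Id)
qed

lemma simple_last_determined:
  assumes "sev (spike l Rt) (w @ [l]) = sev (spike l Rt) (w' @ [l'])" and "fst l \<notin> vars w"
  shows "l' = l \<and> fst l \<notin> vars w'"
proof -
  have "fst y \<noteq> fst l" if "y \<in> set w" for y using assms(2) that by (metis image_eqI)
  then have "sev (spike l Rt) (w @ [l]) = Rt" by (auto simp: sev_Rt sval_spike_Rt sval_spike_Id)
  then show ?thesis using assms(1) by (auto simp: sev_Rt sval_spike_Rt sval_spike_Id)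
qed

text \<open>If the first and the last letter have the same variable, a copy in the middle makes
  both of them recur there, so that afterwards the middle alone decides which end letters are
  replaceable.\<close>
lemma saturate:
  assumes "length w \<ge> 2"
  shows "\<exists>h m l. seq w (h # m @ [l]) \<and> (fst h = fst l \<longrightarrow> fst h \<in> vars m)"
proof -
  obtain h w' where w: "w = h # w'" "w' \<noteq> []" using assms by (cases w; cases "tl w") auto
  obtain m l where w': "w' = m @ [l]" using w(2) by (cases w' rule: rev_cases) auto
  show ?thesis
  proof (cases "fst h = fst l \<and> fst h \<notin> vars m")
    case False
    then show ?thesis using w w' by (intro exI[of _ h] exI[of _ m] exI[of _ l]) auto
  next
    case True
    then have "l = h \<or> l = flip h" using same_variable by metis
    then have "seq w (h # (h # m) @ [l])"
      using saturate_same[of "[h]" m] saturate_flip[of "[h]" m] by (auto simp: w w')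
    then show ?thesis by (intro exI[of _ h] exI[of _ "h # m"] exI[of _ l]) auto
  qed
qed

lemma seq_sev: "seq u v \<Longrightarrow> u \<noteq> [] \<Longrightarrow> sev \<phi> u = sev \<phi> v"
  using side.short_weq_sound[of u v] by (auto simp: holds_wval)

text \<open>End letters whose variable misses the middle are determined by evaluation, and this
  forces the middles to have the same variables. The other end letters are replaceable on both
  sides.\<close>
lemma saturated_unique:
  assumes agree: "\<And>\<phi>. sev \<phi> (h # m @ [l]) = sev \<phi> (h' # m' @ [l'])"
    and sat: "fst h = fst l \<longrightarrow> fst h \<in> vars m" "fst h' = fst l' \<longrightarrow> fst h' \<in> vars m'"
  shows "seq (h # m @ [l]) (h' # m' @ [l'])"
proof -
  have vars: "vars (h # m @ [l]) = vars (h' # m' @ [l'])"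
    using side_agree_vars[of "h # m @ [l]" "h' # m' @ [l']"]
      side_agree_vars[of "h' # m' @ [l']" "h # m @ [l]"] agree by (metis list.discI subset_antisym)
  have agree_last: "sev \<phi> ((h # m) @ [l]) = sev \<phi> ((h' # m') @ [l'])" for \<phi> using agree by simp
  have head: "h' = h \<and> fst h \<notin> vars m'" if "fst h \<notin> vars m"
  proof -
    have "fst h \<notin> vars (m @ [l])" using that sat(1) by (cases "fst h = fst l") simp_all
    from simple_head_determined[OF agree this] show ?thesis by auto
  qed
  have head': "h' = h \<and> fst h' \<notin> vars m" if "fst h' \<notin> vars m'"
  proof -
    have "fst h' \<notin> vars (m' @ [l'])" using that sat(2) by (cases "fst h' = fst l'") simp_all
    from simple_head_determined[OF agree[symmetric] this] show ?thesis by auto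
  qed
  have last: "l' = l \<and> fst l \<notin> vars m'" if "fst l \<notin> vars m"
  proof -
    have "fst l \<notin> vars (h # m)" using that sat(1) by (cases "fst h = fst l") simp_all
    from simple_last_determined[OF agree_last this] show ?thesis by auto
  qed
  have last': "l' = l \<and> fst l' \<notin> vars m" if "fst l' \<notin> vars m'"
  proof -
    have "fst l' \<notin> vars (h' # m')" using that sat(2) by (cases "fst h' = fst l'") simp_all
    from simple_last_determined[OF agree_last[symmetric] this] show ?thesis by auto
  qed
  have "vars m = vars m'"
  proof (intro subset_antisym subsetI; rule ccontr)
    fix n assume n: "n \<in> vars m" "n \<notin> vars m'"
    then have "n = fst h' \<or> n = fst l'" using vars by (simp add: set_eq_iff) metis
    then show False using n head' last' by metis
  next
    fix n assume n: "n \<in> vars m'" "n \<notin> vars m"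
    then have "n = fst h \<or> n = fst l" using vars by (simp add: set_eq_iff) metis
    then show False using n head last by metis
  qed
  note mid = this
  then have "seq (h # m @ [l]) (h # m' @ [l])"
    using middle_cong[of "[h]" "[l]" m m'] by simp
  also have "seq \<dots> (h' # m' @ [l])"
  proof (cases "h' = h")
    case False
    then have "fst h \<in> vars m'" "fst h' \<in> vars m'" using head head' mid by metis+
    then show ?thesis by (rule head_cong)
  qed simp
  also have "seq \<dots> (h' # m' @ [l'])"
  proof (cases "l' = l")
    case False
    then have "fst l \<in> vars m'" "fst l' \<in> vars m'" using last last' mid by metis+
    then show ?thesis by (rule last_cong)
  qed simp
  finally show ?thesis .
qed

text \<open>Where the first letter \<open>x\<close> has the value \<open>Lt\<close>, a second
  letter would have to be \<open>Id\<close>; but it has the variable of \<open>x\<close>, because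
  the two words have the same variables.\<close>
lemma letter_unique:
  assumes "v \<noteq> []" and agree: "\<And>\<phi>. sev \<phi> [x] = sev \<phi> v"
  shows "v = [x]"
proof -
  obtain h w where v: "v = h # w" using assms(1) by (cases v) auto
  have "sev (spike x Lt) v = Lt" using agree[of "spike x Lt", symmetric] by (simp add: sval_spike_Lt)
  then have h: "h = x" "\<forall>y\<in>set w. fst y \<noteq> fst x"
    by (auto simp: v sev_Lt sval_spike_Lt sval_spike_Id)
  moreover have "vars v \<subseteq> {fst x}" using side_agree_vars[of "[x]" v] agree assms(1) by simp
  ultimately have "w = []" by (cases w) (auto simp: v)
  then show ?thesis using h v by simp
qed

lemma side_complete:
  assumes "holds UNIV smul sstar u v"
  shows "seq u v"
proof -
  have ne: "u \<noteq> []" "v \<noteq> []" and agree: "\<And>\<phi>. sev \<phi> u = sev \<phi> v" using assms by (auto simp: holds_wval)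
  consider x where "u = [x]" | x where "v = [x]" | "length u \<ge> 2" "length v \<ge> 2"
    using ne by (cases u; cases v; cases "tl u"; cases "tl v") auto
  then show ?thesis
  proof cases
    case 1
    then show ?thesis using letter_unique[of v x] ne agree by simp
  next
    case 2
    then show ?thesis using letter_unique[of u x] ne agree by simp
  next
    case 3
    obtain h m l where u: "seq u (h # m @ [l])" "fst h = fst l \<longrightarrow> fst h \<in> vars m"
      using saturate[OF 3(1)] by blast
    obtain h' m' l' where v: "seq v (h' # m' @ [l'])" "fst h' = fst l' \<longrightarrow> fst h' \<in> vars m'"
      using saturate[OF 3(2)] by blast
    have "seq (h # m @ [l]) (h' # m' @ [l'])"
      using agree seq_sev[OF u(1) ne(1)] seq_sev[OF v(1) ne(2)] u(2) v(2) by (intro saturated_unique) auto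
    then show ?thesis using u(1) v(1) by (meson weq_sym weq_trans)
  qed
qed

theorem side_finitely_based: "finitely_based UNIV smul sstar"
  by (intro side.finitely_based_short side_complete)

section \<open>The triangular semigroups and their laws\<close>

text \<open>The elements \<open>E\<close>, \<open>C\<close>, \<open>F\<close> behave like the
  matrix units \<open>e\<^sub>1\<^sub>1\<close>, \<open>e\<^sub>1\<^sub>2\<close>,
  \<open>e\<^sub>2\<^sub>2\<close>, except that for \<open>s\<close> true the product \<open>E
  F\<close> is \<open>C\<close> instead of zero. The two semigroups are known as
  \<open>A\<^sub>0\<close> (for \<open>s\<close> true) and \<open>B\<^sub>0\<close> (for
  \<open>s\<close> false). The identities of the first hold in the second as far as they are used
  here, so one parameter serves both.\<close>
datatype tri = E | F | C | Z

fun tmul :: "bool \<Rightarrow> tri \<Rightarrow> tri \<Rightarrow> tri" where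
  "tmul s E E = E"
| "tmul s F F = F"
| "tmul s E C = C"
| "tmul s C F = C"
| "tmul s E F = (if s then C else Z)"
| "tmul s _ _ = Z"

fun tstar :: "tri \<Rightarrow> tri" where
  "tstar E = F"
| "tstar F = E"
| "tstar C = C"
| "tstar Z = Z"

lemma tstar_tstar [simp]: "tstar (tstar x) = x"
  by (cases x) auto

lemma tmul_Z [simp]: "tmul s Z x = Z" "tmul s x Z = Z"
  by (cases x; simp)+

lemma tmul_assoc: "tmul s (tmul s x y) z = tmul s x (tmul s y z)"
  by (cases x; cases y; cases z) auto

interpretation tri: involution_semigroup UNIV "tmul s" tstar for s
proof
  fix x y :: tri
  show "tstar (tmul s x y) = tmul s (tstar y) (tstar x)" by (cases x; cases y) auto
qed (auto simp: tmul_assoc)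

abbreviation teq :: "bool \<Rightarrow> word \<Rightarrow> word \<Rightarrow> bool" where
  "teq s \<equiv> short_weq UNIV (tmul s) tstar"

text \<open>The word \<open>z z\<^sup>* z\<close>, whose value is zero under every
  assignment.\<close>
abbreviation null_word :: word where
  "null_word \<equiv> [(0, False), (0, True), (0, False)]"

lemma all_tri: "(\<forall>x. P x) \<longleftrightarrow> P E \<and> P F \<and> P C \<and> P Z"
  by (metis tri.exhaust)

lemmas check_law = all_tri pick_def flip_pair

text \<open>A letter that occurs twice has the value \<open>E\<close> or \<open>F\<close> in a
  nonzero evaluation, and everything between its two occurrences has the same value. The next three
  rules express that such a stretch of a word is determined by its set of letters.\<close>
lemma sandwich_square:
  assumes "x \<noteq> []" and "y \<noteq> []"
  shows "teq s (x @ y @ x) (x @ y @ x @ y)"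
  using short_law[of "tmul s" tstar "[(0, False), (1, False), (0, False)]" "[(0, False), (1, False), (0, False), (1, False)]" x y x x] assms
    by (cases s) (simp_all add: check_law)

lemma sandwich_swap:
  assumes "x \<noteq> []" and "y \<noteq> []"
  shows "teq s (x @ y @ x) (y @ x @ y)"
  using short_law[of "tmul s" tstar "[(0, False), (1, False), (0, False)]" "[(1, False), (0, False), (1, False)]" x y x x] assms
    by (cases s) (simp_all add: check_law)

lemma insert_repeated:
  assumes "x \<noteq> []"
  shows "teq s (x @ u @ v @ x) (x @ u @ x @ v @ x)"
proof -
  consider "u = []" "v = []" | "u = []" "v \<noteq> []" | "u \<noteq> []" "v = []" | "u \<noteq> []" "v \<noteq> []"
    by blast
  then show ?thesis
  proof cases
    case 1
    then show ?thesis
      using short_law[of "tmul s" tstar "[(0, False), (0, False)]" "[(0, False), (0, False), (0, False)]" x x x x] assms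
    by (cases s) (simp_all add: check_law)
  next
    case 2
    then show ?thesis
      using short_law[of "tmul s" tstar "[(1, False), (0, False), (1, False)]" "[(1, False), (1, False), (0, False), (1, False)]" v x v v] assms
    by (cases s) (simp_all add: check_law)
  next
    case 3
    then show ?thesis
      using short_law[of "tmul s" tstar "[(1, False), (0, False), (1, False)]" "[(1, False), (0, False), (1, False), (1, False)]" u x u u] assms
    by (cases s) (simp_all add: check_law)
  next
    case 4
    then show ?thesis
      using short_law[of "tmul s" tstar "[(2, False), (0, False), (1, False), (2, False)]" "[(2, False), (0, False), (2, False), (1, False), (2, False)]" u v x u] assms
    by (cases s) (simp_all add: check_law)
  qed
qed

text \<open>If a word contains \<open>x\<close> and later \<open>x\<^sup>*\<close>, a nonzero
  evaluation gives \<open>x\<close> the value \<open>E\<close> and changes from \<open>E\<close> to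
  \<open>F\<close> between them. Letters outside are thereby forced, and it is irrelevant on which
  side and in which order they are recorded. In the rules below \<open>r\<close> is the part where
  the change takes place, and it may be empty.\<close>
lemma shell_swap:
  assumes "x \<noteq> []" and "y \<noteq> []"
  shows "teq s (x @ y @ r @ inv_word y @ inv_word x) (y @ x @ r @ inv_word x @ inv_word y)"
proof (cases "r = []")
  case True
  then show ?thesis
    using short_law[of "tmul s" tstar "[(0, False), (1, False), (1, True), (0, True)]" "[(1, False), (0, False), (0, True), (1, True)]" x y x x] assms
    by (cases s) (simp_all add: check_law)
next
  case False
  then show ?thesis
    using short_law[of "tmul s" tstar "[(1, False), (2, False), (0, False), (2, True), (1, True)]" "[(2, False), (1, False), (0, False), (1, True), (2, True)]" r x y r] assms
    by (cases s) (simp_all add: check_law)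
qed

lemma shell_idem:
  assumes "x \<noteq> []"
  shows "teq s (x @ x @ r @ inv_word x @ inv_word x) (x @ r @ inv_word x)"
proof (cases "r = []")
  case True
  then show ?thesis
    using short_law[of "tmul s" tstar "[(0, False), (0, False), (0, True), (0, True)]" "[(0, False), (0, True)]" x x x x] assms
    by (cases s) (simp_all add: check_law)
next
  case False
  then show ?thesis
    using short_law[of "tmul s" tstar "[(1, False), (1, False), (0, False), (1, True), (1, True)]" "[(1, False), (0, False), (1, True)]" r x r r] assms
    by (cases s) (simp_all add: check_law)
qed

lemma shell_complete:
  assumes "x \<noteq> []" and "y \<noteq> []"
  shows "teq s (x @ y @ r @ inv_word y) (x @ y @ r @ inv_word y @ inv_word x)"
proof (cases "r = []")
  case True
  then show ?thesis
    using short_law[of "tmul s" tstar "[(0, False), (1, False), (1, True)]" "[(0, False), (1, False), (1, True), (0, True)]" x y x x] assms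
    by (cases s) (simp_all add: check_law)
next
  case False
  then show ?thesis
    using short_law[of "tmul s" tstar "[(1, False), (2, False), (0, False), (2, True)]" "[(1, False), (2, False), (0, False), (2, True), (1, True)]" r x y r] assms
    by (cases s) (simp_all add: check_law)
qed

lemma shell_absorb:
  assumes "x \<noteq> []" and "y \<noteq> []"
  shows "teq s (y @ r @ inv_word y @ x) (inv_word x @ y @ r @ inv_word y @ x)"
proof (cases "r = []")
  case True
  then show ?thesis
    using short_law[of "tmul s" tstar "[(1, False), (1, True), (0, False)]" "[(0, True), (1, False), (1, True), (0, False)]" x y x x] assms
    by (cases s) (simp_all add: check_law)
next
  case False
  then show ?thesis
    using short_law[of "tmul s" tstar "[(2, False), (0, False), (2, True), (1, False)]" "[(1, True), (2, False), (0, False), (2, True), (1, False)]" r x y r] assms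
    by (cases s) (simp_all add: check_law)
qed

text \<open>All nonzero values here are \<open>C\<close>, which the star fixes, so the word may be
  replaced by its star.\<close>
lemma shell_reverse:
  assumes "r \<noteq> []" and "x \<noteq> []"
  shows "teq s (x @ r @ inv_word x) (x @ inv_word r @ inv_word x)"
  using short_law[of "tmul s" tstar "[(1, False), (0, False), (1, True)]" "[(1, False), (0, True), (1, True)]" r x r r] assms
    by (cases s) (simp_all add: check_law)

lemma shell_clash:
  assumes "x \<noteq> []"
  shows "teq s (inv_word x @ x @ r @ inv_word x @ x) null_word"
proof (cases "r = []")
  case True
  then show ?thesis
    using short_law[of "tmul s" tstar "[(0, True), (0, False), (0, True), (0, False)]" "[(1, False), (1, True), (1, False)]" x "[(0, False)]" x x] assms
    by (cases s) (simp_all add: check_law)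
next
  case False
  then show ?thesis
    using short_law[of "tmul s" tstar "[(1, True), (1, False), (0, False), (1, True), (1, False)]" "[(2, False), (2, True), (2, False)]" r x "[(0, False)]" r] assms
    by (cases s) (simp_all add: check_law)
qed

lemma null_left:
  assumes "x \<noteq> []"
  shows "teq s (x @ null_word) null_word"
  using short_law[of "tmul s" tstar "[(0, False), (1, False), (1, True), (1, False)]" "[(1, False), (1, True), (1, False)]" x "[(0, False)]" x x] assms
    by (cases s) (simp_all add: check_law)

lemma null_right:
  assumes "x \<noteq> []"
  shows "teq s (null_word @ x) null_word"
  using short_law[of "tmul s" tstar "[(1, False), (1, True), (1, False), (0, False)]" "[(1, False), (1, True), (1, False)]" x "[(0, False)]" x x] assms
    by (cases s) (simp_all add: check_law)

text \<open>For \<open>s\<close> false the change from \<open>E\<close> to \<open>F\<close> needs a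
  letter with value \<open>C\<close>, and such a letter occurs only once. Nothing can then be cut
  between adjacent squares, and squares next to the shell are forced.\<close>
lemma squares_merge:
  assumes "x \<noteq> []" and "y \<noteq> []"
  shows "teq False (x @ x @ y @ y) (x @ y @ x @ y)"
  using short_law[of "tmul False" tstar "[(0, False), (0, False), (1, False), (1, False)]" "[(0, False), (1, False), (0, False), (1, False)]" x y x x] assms
    by (simp add: check_law)

lemma shell_square_left:
  assumes "d \<noteq> []" and "x \<noteq> []"
  shows "teq False (d @ x @ x @ r @ inv_word d) (d @ x @ r @ inv_word x @ inv_word d)"
proof (cases "r = []")
  case True
  then show ?thesis
    using short_law[of "tmul False" tstar "[(0, False), (1, False), (1, False), (0, True)]" "[(0, False), (1, False), (1, True), (0, True)]" d x d d] assms
    by (simp add: check_law)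
next
  case False
  then show ?thesis
    using short_law[of "tmul False" tstar "[(0, False), (2, False), (2, False), (1, False), (0, True)]" "[(0, False), (2, False), (1, False), (2, True), (0, True)]" d r x d] assms
    by (simp add: check_law)
qed

lemma shell_square_right:
  assumes "d \<noteq> []" and "x \<noteq> []"
  shows "teq False (d @ r @ x @ x @ inv_word d) (d @ inv_word x @ r @ x @ inv_word d)"
proof (cases "r = []")
  case True
  then show ?thesis
    using short_law[of "tmul False" tstar "[(0, False), (1, False), (1, False), (0, True)]" "[(0, False), (1, True), (1, False), (0, True)]" d x d d] assms
    by (simp add: check_law)
next
  case False
  then show ?thesis
    using short_law[of "tmul False" tstar "[(0, False), (1, False), (2, False), (2, False), (0, True)]" "[(0, False), (2, True), (1, False), (2, False), (0, True)]" d r x d] assms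
    by (simp add: check_law)
qed

lemma shell_empty:
  assumes "d \<noteq> []"
  shows "teq False (d @ inv_word d) null_word"
  using short_law[of "tmul False" tstar "[(0, False), (0, True)]" "[(1, False), (1, True), (1, False)]" d "[(0, False)]" d d] assms
    by (simp add: check_law)

section \<open>Rewriting words to chains\<close>

context
  fixes s :: bool
begin

abbreviation teq_local (infix "\<approx>" 50) where
  "u \<approx> v \<equiv> teq s u v"

text \<open>Each letter \<open>y\<close> of \<open>p\<close> is inserted between two occurrences of
  \<open>y\<close> in the copies of \<open>L\<close>.\<close>
lemma square_absorb:
  assumes "set p \<subseteq> set L"
  shows "L @ L \<approx> L @ p @ L"
  using assms
proof (induction p rule: rev_induct)
  case (snoc y p)
  then obtain L1 L2 where L: "L = L1 @ y # L2" by (auto dest: split_list)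
  have "L @ p @ L \<approx> L @ (p @ [y]) @ L"
    by (rule weq_step[OF insert_repeated[of "[y]" s "L2 @ p" L1], of _ L1 L2]) (auto simp: L)
  with snoc show ?case by (auto elim: weq_trans)
qed simp

lemma square_cong:
  assumes "set L = set M" and "L \<noteq> []"
  shows "L @ L \<approx> M @ M"
proof -
  have "M \<noteq> []" using assms by auto
  have "L @ L \<approx> L @ M @ L" using assms by (intro square_absorb) auto
  also have "\<dots> \<approx> M @ L @ M" using assms \<open>M \<noteq> []\<close> by (intro sandwich_swap)
  also have "\<dots> \<approx> M @ M" using assms by (intro weq_sym[OF square_absorb]) auto
  finally show ?thesis .
qed

lemma repeated_letter_square: "[x] @ u @ [x] \<approx> (x # u) @ (x # u)"
  using sandwich_square[of "[x]" u s] by (cases "u = []") auto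

text \<open>Blocks serve as the parts of a word that no consistent cut divides. A single letter
  differs from its square because only the former can take the value \<open>C\<close>.\<close>
definition block :: "word \<Rightarrow> bool" where
  "block B \<longleftrightarrow> (\<exists>x. B = [x]) \<or> (\<exists>N. N \<noteq> [] \<and> B = N @ N)"

lemma block_letter [simp]: "block [x]"
  and block_square: "N \<noteq> [] \<Longrightarrow> block (N @ N)"
  by (auto simp: block_def)

lemma block_nonempty: "block B \<Longrightarrow> B \<noteq> []"
  by (auto simp: block_def)

text \<open>A square may be rewritten so that any prescribed letter comes last, as only its set of
  letters matters.\<close>
lemma block_end_at:
  assumes "block B" and "x \<in> set B"
  obtains B' where "B \<approx> B' @ [x]" and "set (B' @ [x]) = set B"
proof (cases "\<exists>N. N \<noteq> [] \<and> B = N @ N")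
  case True
  then obtain N where N: "N \<noteq> []" "B = N @ N" by blast
  then have "B \<approx> (N @ x # N) @ [x]"
    using assms square_cong[of N "N @ [x]"] by auto
  then show ?thesis using that[of "N @ x # N"] assms N by auto
next
  case False
  then show ?thesis using assms that[of "[]"] by (auto simp: block_def)
qed

lemma block_start_at:
  assumes "block B" and "x \<in> set B"
  obtains B' where "B \<approx> x # B'" and "set (x # B') = set B"
proof (cases "\<exists>N. N \<noteq> [] \<and> B = N @ N")
  case True
  then obtain N where N: "N \<noteq> []" "B = N @ N" by blast
  then have "B \<approx> x # (N @ x # N)"
    using assms square_cong[of N "x # N"] by auto
  then show ?thesis using that[of "N @ x # N"] assms N by auto
next
  case False
  then show ?thesis using assms that[of "[]"] by (auto simp: block_def)
qed

text \<open>A letter that recurs behind a block glues everything from this block onwards into one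
  square.\<close>
lemma block_close:
  assumes "block B" and "x \<in> set B"
  obtains N where "N \<noteq> []" and "B @ u @ [x] \<approx> N @ N" and "set N = set B \<union> set u"
proof -
  obtain B' where B': "B \<approx> x # B'" "set (x # B') = set B"
    using block_start_at[OF assms] by blast
  have "B @ u @ [x] \<approx> (x # B') @ u @ [x]"
    by (rule weq_step[OF B'(1), of _ "[]"]) auto
  also have "\<dots> \<approx> (x # B' @ u) @ (x # B' @ u)"
    using repeated_letter_square[of x "B' @ u"] by simp
  finally show ?thesis using that[of "x # B' @ u"] B'(2) by auto
qed

text \<open>The word \<open>L\<close> collects the letters that every nonzero evaluation sends to
  \<open>E\<close>.\<close>
definition shell :: "word \<Rightarrow> word \<Rightarrow> word" where
  "shell L r = L @ r @ inv_word L"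

lemma shell_simps: "shell (K @ L) r = shell K (shell L r)" "shell [] r = r"
  by (auto simp: shell_def)

lemma shell_cong: "r \<approx> r' \<Longrightarrow> shell L r \<approx> shell L r'"
  by (simp add: shell_def weq_context)

lemma shell_commute: "shell (x @ y) r \<approx> shell (y @ x) r"
  using shell_swap[of x y s r] by (cases "x = [] \<or> y = []") (auto simp: shell_def)

text \<open>Rotate \<open>L\<close> until \<open>a\<close> is in front, double it there, and undo
  the rotation behind the new copy.\<close>
lemma shell_mem:
  assumes "a \<in> set L"
  shows "shell L r \<approx> shell (a # L) r"
proof -
  from assms obtain u v where L: "L = u @ a # v" by (auto dest: split_list)
  have swap: "shell L r \<approx> shell ((a # v) @ u) r"
    using shell_commute[of u "a # v"] by (simp add: L)
  also have "\<dots> \<approx> shell ([a] @ (a # v) @ u) r"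
    using weq_sym[OF shell_idem[of "[a]" s "shell (v @ u) r"]] by (simp add: shell_def)
  also have "\<dots> \<approx> shell (a # L) r"
    using shell_cong[OF weq_sym[OF swap], of "[a]"] by (simp add: shell_def)
  finally show ?thesis .
qed

lemma shell_absorb_left: "set p \<subseteq> set L \<Longrightarrow> shell L r \<approx> shell (p @ L) r"
proof (induction p)
  case (Cons a p)
  then have "shell L r \<approx> shell (p @ L) r" by simp
  also have "\<dots> \<approx> shell (a # p @ L) r" using Cons by (intro shell_mem) auto
  finally show ?case by simp
qed simp

lemma shell_set_cong:
  assumes "set L = set M"
  shows "shell L r \<approx> shell M r"
proof -
  have "shell L r \<approx> shell (M @ L) r" using assms by (intro shell_absorb_left) auto
  also have "\<dots> \<approx> shell (L @ M) r" by (rule shell_commute)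
  also have "\<dots> \<approx> shell M r" using assms by (intro weq_sym[OF shell_absorb_left]) auto
  finally show ?thesis .
qed

text \<open>A letter that occurs starred in a block and unstarred behind it, or the other way
  round, fixes the value of everything up to the end of the block. The block is first rewritten to
  end in that letter.\<close>
lemma shell_create:
  assumes "block B" and "flip x \<in> set B"
  shows "p @ B @ q @ [x] \<approx> shell (p @ B) q"
proof -
  obtain B' where B': "B \<approx> B' @ [flip x]" "set (B' @ [flip x]) = set B"
    using block_end_at[OF assms] by blast
  have "p @ B @ q @ [x] \<approx> p @ (B' @ [flip x]) @ q @ [x]"
    by (rule weq_step[OF B'(1), of _ p "q @ [x]"]) auto
  also have "\<dots> \<approx> shell (p @ B' @ [flip x]) q"
    using shell_complete[of "p @ B'" "[flip x]" s q]
    by (cases "p @ B' = []") (auto simp: shell_def)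
  also have "\<dots> \<approx> shell (p @ B) q"
    using B'(2) by (intro shell_set_cong) auto
  finally show ?thesis .
qed

text \<open>Everything to the right of the shell has the value \<open>F\<close>, so it may be
  recorded inverted on the left.\<close>
lemma shell_append:
  assumes "L \<noteq> []" and "x \<noteq> []"
  shows "shell L r @ x \<approx> shell (inv_word x @ L) r"
  using shell_absorb[of x L s r] assms by (simp add: shell_def)

text \<open>A letter \<open>y\<close> of the shell has the value \<open>E\<close>; if it recurs in
  a block of the core, then so has everything in the core up to the end of this block.\<close>
lemma shell_absorb_prefix:
  assumes "y \<in> set L" and "block B" and "y \<in> set B"
  shows "shell L (p @ B @ q) \<approx> shell (L @ p @ B) q"
proof -
  obtain B' where B': "B \<approx> B' @ [y]" "set (B' @ [y]) = set B"
    using block_end_at[OF assms(2,3)] by blast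
  have "shell L (p @ B @ q) \<approx> shell (L @ [y]) (p @ B @ q)"
    using assms(1) by (intro shell_set_cong) auto
  also have "\<dots> \<approx> shell (L @ [y]) (p @ (B' @ [y]) @ q)"
    by (intro shell_cong weq_context B')
  also have "\<dots> \<approx> shell L (shell (y # p @ B' @ [y]) q)"
    using shell_cong[OF shell_complete[of "y # p @ B'" "[y]" s q], of L] by (simp add: shell_def)
  also have "\<dots> \<approx> shell (L @ p @ B) q"
    unfolding shell_simps[symmetric] using B'(2) assms(1) by (intro shell_set_cong) auto
  finally show ?thesis .
qed

text \<open>The mirror image: \<open>y\<^sup>*\<close> has the value \<open>F\<close>, and so has
  everything from its block onwards.\<close>
lemma shell_absorb_suffix:
  assumes "y \<in> set L" and "block B" and "flip y \<in> set B"
  shows "shell L (p @ B @ q) \<approx> shell (L @ inv_word (B @ q)) p"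
proof -
  obtain B' where B': "B \<approx> flip y # B'" "set (flip y # B') = set B"
    using block_start_at[OF assms(2,3)] by blast
  let ?z = "B' @ q @ [flip y]"
  have "shell L (p @ B @ q) \<approx> shell (L @ [y]) (p @ B @ q)"
    using assms(1) by (intro shell_set_cong) auto
  also have "\<dots> \<approx> shell (L @ [y]) (p @ (flip y # B') @ q)"
    by (intro shell_cong weq_context B')
  also have "\<dots> = shell L (shell [y] p @ ?z)"
    by (simp add: shell_def)
  also have "\<dots> \<approx> shell L (shell (inv_word ?z @ [y]) p)"
    by (intro shell_cong shell_append) auto
  also have "\<dots> \<approx> shell (L @ inv_word (B @ q)) p"
    unfolding shell_simps(1)[symmetric] using assms(1,3) B'(2)[symmetric]
    by (intro shell_set_cong) (auto simp: in_flip_image)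
  finally show ?thesis .
qed

lemma shell_null:
  assumes "x \<in> set L" and "flip x \<in> set L"
  shows "shell L r \<approx> null_word"
proof -
  have "shell L r \<approx> shell (L @ [flip x, x]) r"
    using assms by (intro shell_set_cong) auto
  also have "\<dots> \<approx> shell L null_word"
    using shell_cong[OF shell_clash[of "[x]" s r]] by (simp add: shell_def)
  also have "\<dots> \<approx> null_word @ inv_word L"
    unfolding shell_def using assms by (intro weq_step[OF null_left[of L], of _ "[]" "inv_word L"]) auto
  also have "\<dots> \<approx> null_word"
    using assms by (intro null_right) auto
  finally show ?thesis .
qed

definition consistent :: "word \<Rightarrow> bool" where
  "consistent w \<longleftrightarrow> (\<forall>x\<in>set w. flip x \<notin> set w)"

abbreviation disjoint_words :: "word \<Rightarrow> word \<Rightarrow> bool" where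
  "disjoint_words u v \<equiv> set u \<inter> set v = {}"

text \<open>The normal forms \<open>shell L (concat Bs)\<close>. An empty \<open>L\<close> is
  allowed and stands for words in which no variable occurs both with and without star; these have
  the additional nonzero evaluations that are constantly \<open>E\<close> or constantly
  \<open>F\<close>.\<close>
definition chain :: "word \<Rightarrow> word list \<Rightarrow> bool" where
  "chain L Bs \<longleftrightarrow> (L \<noteq> [] \<or> Bs \<noteq> []) \<and> (\<forall>B\<in>set Bs. block B) \<and>
     sorted_wrt disjoint_words (L # Bs) \<and> consistent (L @ concat Bs)"

lemma consistent_flip_part:
  assumes "consistent (u @ v)" and "disjoint_words u v"
  shows "consistent (u @ inv_word v)" and "disjoint_words u (inv_word v)"
  using assms by (auto simp: consistent_def disjoint_iff)

lemma chain_split: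
  assumes "chain L (P @ Q)"
  shows "disjoint_words (L @ concat P) (concat Q)" and "disjoint_words L (concat P)"
    and "sorted_wrt disjoint_words P" and "sorted_wrt disjoint_words Q"
    and "\<forall>B\<in>set (P @ Q). block B" and "consistent (L @ concat P @ concat Q)"
  using assms by (auto simp: chain_def sorted_wrt_append disjoint_iff)

lemma chainI:
  assumes "L \<noteq> [] \<or> Bs \<noteq> []" and "\<And>B. B \<in> set Bs \<Longrightarrow> block B" and "sorted_wrt disjoint_words Bs"
    and "disjoint_words L (concat Bs)" and "consistent (L @ concat Bs)"
  shows "chain L Bs"
  using assms by (auto simp: chain_def)

text \<open>A new letter either repeats a letter of a block and closes a square, or it is the star
  of a letter and creates a shell, or it becomes a block of its own.\<close>
lemma chain_append_letter:
  assumes "chain [] Bs"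
  shows "(\<exists>L Bs'. chain L Bs' \<and> concat Bs @ [x] \<approx> shell L (concat Bs'))"
proof -
  consider "x \<in> set (concat Bs)" | "flip x \<in> set (concat Bs)"
    | "x \<notin> set (concat Bs)" "flip x \<notin> set (concat Bs)" by blast
  then show ?thesis
  proof cases
    case 1
    then obtain P B Q where Bs: "Bs = P @ B # Q" and x: "x \<in> set B"
      by (auto dest!: split_list)
    have "block B" using assms Bs by (auto simp: chain_def)
    from block_close[OF this x, of "concat Q"] obtain N where
      N: "N \<noteq> []" "B @ concat Q @ [x] \<approx> N @ N" "set N = set B \<union> set (concat Q)" .
    have "concat Bs @ [x] \<approx> shell [] (concat (P @ [N @ N]))"
      by (rule weq_step[OF N(2), of _ "concat P" "[]"]) (auto simp: Bs shell_def)
    moreover have "chain [] (P @ [N @ N])"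
      using assms N(1,3) block_square[OF N(1)]
      by (auto simp: chain_def Bs sorted_wrt_append consistent_def disjoint_iff)
    ultimately show ?thesis by blast
  next
    case 2
    then obtain P B Q where Bs: "Bs = P @ B # Q" and x: "flip x \<in> set B"
      by (auto dest!: split_list)
    have B: "block B" using assms Bs by (auto simp: chain_def)
    have "concat Bs @ [x] \<approx> shell (concat P @ B) (concat Q)"
      using shell_create[OF B x] by (simp add: Bs)
    moreover have "chain (concat P @ B) Q"
      using assms block_nonempty[OF B]
      by (auto simp: chain_def Bs sorted_wrt_append consistent_def disjoint_iff)
    ultimately show ?thesis by blast
  next
    case 3
    then have "chain [] (Bs @ [[x]])"
      using assms by (auto simp: chain_def sorted_wrt_append consistent_def)
    then show ?thesis by (intro exI[of _ "[]"] exI[of _ "Bs @ [[x]]"]) (simp add: shell_def)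
  qed
qed


text \<open>Letters are appended one by one. Once there is a shell, the star of the new letter
  joins it. If this makes the shell contradictory the word vanishes, and if it meets the core, part
  of the core is absorbed. The absorbed blocks are disjoint from the others, so the result is a
  chain again.\<close>
lemma chain_cases:
  assumes "w \<noteq> []"
  shows "(\<exists>L Bs. chain L Bs \<and> w \<approx> shell L (concat Bs)) \<or> w \<approx> null_word"
  using assms
proof (induction w rule: rev_induct)
  case (snoc x w)
  show ?case
  proof (cases "w = []")
    case True
    have "chain [] [[x]]" by (auto simp: chain_def consistent_def)
    then show ?thesis using True
      by (intro disjI1 exI[of _ "[]"] exI[of _ "[[x]]"]) (simp add: shell_def)
  next
    case False
    with snoc.IH consider (null) "w \<approx> null_word"
      | (plain) Bs where "chain [] Bs" "w \<approx> concat Bs"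
      | (shell) L Bs where "chain L Bs" "L \<noteq> []" "w \<approx> shell L (concat Bs)"
      by (metis shell_simps(2))
    then show ?thesis
    proof cases
      case null
      have "w @ [x] \<approx> null_word @ [x]" using weq_append[OF null] by simp
      also have "\<dots> \<approx> null_word" by (intro null_right) simp
      finally show ?thesis ..
    next
      case plain
      have "w @ [x] \<approx> concat Bs @ [x]" using weq_append[OF plain(2)] by simp
      then show ?thesis using chain_append_letter[OF plain(1), of x] weq_trans by blast
    next
      case shell
      let ?K = "flip x # L"
      have "w @ [x] \<approx> shell L (concat Bs) @ [x]" using weq_append[OF shell(3)] by simp
      also have "\<dots> \<approx> shell ?K (concat Bs)"
        using shell_append[OF shell(2), of "[x]"] by simp
      finally have w: "w @ [x] \<approx> shell ?K (concat Bs)" .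
      consider (clash) "x \<in> set L" | (suffix) "x \<in> set (concat Bs)"
        | (prefix) "flip x \<in> set (concat Bs)"
        | (new) "x \<notin> set (L @ concat Bs)" "flip x \<notin> set (concat Bs)" by auto
      then show ?thesis
      proof cases
        case clash
        then have "shell ?K (concat Bs) \<approx> null_word" by (intro shell_null[of x]) auto
        then show ?thesis using w weq_trans by blast
      next
        case suffix
        then obtain P B Q where Bs: "Bs = P @ B # Q" and x: "x \<in> set B"
          by (auto dest!: split_list)
        have B: "block B" using shell Bs by (auto simp: chain_def)
        have "shell ?K (concat Bs) \<approx> shell (?K @ inv_word (B @ concat Q)) (concat P)"
          using shell_absorb_suffix[of "flip x" ?K, OF _ B, of "concat P" "concat Q"] x by (simp add: Bs)
        moreover have "chain (?K @ inv_word (B @ concat Q)) P"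
        proof -
          define R where "R = B @ concat Q"
          note split = chain_split[OF shell(1)[unfolded Bs]]
          have R: "flip x \<in> set (inv_word R)" using x by (simp add: R_def)
          have "consistent ((L @ concat P) @ R)" "disjoint_words (L @ concat P) R"
            using split by (simp_all add: R_def)
          note flipped = consistent_flip_part[OF this]
          have set: "set (?K @ inv_word R) = set (L @ inv_word R)" using R by auto
          have "consistent ((?K @ inv_word R) @ concat P)"
            unfolding consistent_def set_append[of "?K @ inv_word R"] set
            using flipped(1) by (auto simp: consistent_def)
          moreover have "disjoint_words (?K @ inv_word R) (concat P)"
            unfolding set using split(2) flipped(2) by auto
          ultimately show ?thesis
            unfolding R_def[symmetric] using split(3,5) by (intro chainI) auto
        qed
        ultimately show ?thesis using w weq_trans by blast
      next
        case prefix
        then obtain P B Q where Bs: "Bs = P @ B # Q" and x: "flip x \<in> set B"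
          by (auto dest!: split_list)
        have B: "block B" using shell Bs by (auto simp: chain_def)
        have "shell ?K (concat Bs) \<approx> shell (?K @ concat P @ B) (concat Q)"
          using shell_absorb_prefix[of "flip x" ?K, OF _ B, of "concat P" "concat Q"] x by (simp add: Bs)
        moreover have "chain (?K @ concat P @ B) Q"
        proof -
          have "chain L ((P @ [B]) @ Q)" using shell(1) by (simp add: Bs)
          note split = chain_split[OF this]
          have set: "set (?K @ concat P @ B) = set (L @ concat (P @ [B]))" using x by auto
          have "consistent ((?K @ concat P @ B) @ concat Q)"
            unfolding consistent_def set_append[of "?K @ concat P @ B"] set
            using split(6) by (auto simp: consistent_def)
          moreover have "disjoint_words (?K @ concat P @ B) (concat Q)"
            unfolding set using split(1) by auto
          ultimately show ?thesis using split(4,5) by (intro chainI) auto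
        qed
        ultimately show ?thesis using w weq_trans by blast
      next
        case new
        then have "chain ?K Bs"
          using shell(1) by (auto simp: chain_def consistent_def)
        then show ?thesis using w by blast
      qed
    qed
  qed
qed simp

end

section \<open>Evaluating chains\<close>

abbreviation linear :: "word \<Rightarrow> bool" where
  "linear B \<equiv> length B = 1"

lemma nonlinear_block: "block B \<Longrightarrow> \<not> linear B \<Longrightarrow> \<exists>N. N \<noteq> [] \<and> B = N @ N"
  by (auto simp: block_def)

text \<open>For \<open>s\<close> false only linear blocks give rise to nonzero evaluations of a
  core inside a shell, so adjacent squares are merged and squares next to the shell are absorbed.
  After that each remaining block is again visible to the evaluations.\<close>
definition reduced :: "bool \<Rightarrow> word \<Rightarrow> word list \<Rightarrow> bool" where
  "reduced s L Bs \<longleftrightarrow> chain L Bs \<and> (\<not> s \<longrightarrow>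
     (\<forall>P B C Q. Bs = P @ B # C # Q \<longrightarrow> linear B \<or> linear C) \<and>
     (L \<noteq> [] \<longrightarrow> Bs \<noteq> [] \<and> linear (hd Bs) \<and> linear (last Bs)))"

lemma chain_merge:
  assumes "chain L (P @ Q @ R)" and "block D" and "set D = set (concat Q)"
  shows "chain L (P @ D # R)"
proof -
  have sorted: "sorted_wrt disjoint_words (L # P @ Q @ R)" using assms(1) by (simp add: chain_def)
  have "disjoint_words B D" if "B \<in> set P" for B
    unfolding assms(3) using sorted that by (fastforce simp: sorted_wrt_append disjoint_iff)
  moreover have "disjoint_words D B" if "B \<in> set R" for B
    unfolding assms(3) using sorted that by (fastforce simp: sorted_wrt_append disjoint_iff)
  moreover have "disjoint_words L D"
    unfolding assms(3) using sorted by (auto simp: disjoint_iff)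
  ultimately have "sorted_wrt disjoint_words (L # P @ D # R)"
    using sorted by (auto simp: sorted_wrt_append)
  moreover have "set (L @ concat (P @ D # R)) = set (L @ concat (P @ Q @ R))"
    using assms(3) by simp
  ultimately show ?thesis
    using assms(1,2) unfolding chain_def consistent_def by (metis (no_types, lifting) Un_iff append_is_Nil_conv list.discI set_append set_ConsD)
qed

text \<open>Every reduction step removes a block, or else the core is empty and the word
  vanishes.\<close>
lemma chain_cases_reduced_False:
  "chain L Bs \<Longrightarrow> (\<exists>K Cs. reduced False K Cs \<and> teq False (shell L (concat Bs)) (shell K (concat Cs))) \<or>
     teq False (shell L (concat Bs)) null_word"
proof (induction "length Bs" arbitrary: L Bs rule: less_induct)
  case less
  have step: ?case if "length Cs < length Bs" "chain K Cs"
    "teq False (shell L (concat Bs)) (shell K (concat Cs))" for K Cs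
    using less.hyps[OF that(1,2)] that(3) weq_trans by blast
  have blocks: "block B" if "B \<in> set Bs" for B using less.prems that by (auto simp: chain_def)
  consider (reduced) "reduced False L Bs"
    | (adjacent) P B C Q where "Bs = P @ B # C # Q" "\<not> linear B" "\<not> linear C"
    | (empty) "L \<noteq> []" "Bs = []"
    | (first) B Q where "L \<noteq> []" "Bs = B # Q" "\<not> linear B"
    | (last) P B where "L \<noteq> []" "Bs = P @ [B]" "\<not> linear B"
  proof (cases "reduced False L Bs")
    case False
    then consider "\<exists>P B C Q. Bs = P @ B # C # Q \<and> \<not> linear B \<and> \<not> linear C"
      | "L \<noteq> []" "Bs = []" | "L \<noteq> []" "Bs \<noteq> []" "\<not> linear (hd Bs)"
      | "L \<noteq> []" "Bs \<noteq> []" "\<not> linear (last Bs)"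
      using less.prems unfolding reduced_def by blast
    then show ?thesis
    proof cases
      case 1 then show ?thesis using adjacent by blast
    next
      case 2 then show ?thesis using empty by blast
    next
      case 3 then show ?thesis using first[of "hd Bs" "tl Bs"] by simp
    next
      case 4 then show ?thesis using last[of "butlast Bs" "last Bs"] by simp
    qed
  qed
  then show ?case
  proof cases
    case reduced
    then show ?thesis by (intro disjI1 exI[of _ L] exI[of _ Bs]) simp
  next
    case adjacent
    obtain N where N: "N \<noteq> []" "B = N @ N"
      using nonlinear_block[OF blocks adjacent(2)] by (auto simp: adjacent(1))
    obtain M where M: "M \<noteq> []" "C = M @ M"
      using nonlinear_block[OF blocks adjacent(3)] by (auto simp: adjacent(1))
    let ?Cs = "P @ ((N @ M) @ (N @ M)) # Q"
    have "teq False (concat Bs) (concat ?Cs)"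
      by (rule weq_step[OF squares_merge[OF N(1) M(1)], of _ "concat P" "concat Q"])
        (simp_all add: adjacent(1) N(2) M(2))
    then have "teq False (shell L (concat Bs)) (shell L (concat ?Cs))" by (rule shell_cong)
    moreover have "chain L ?Cs"
      using less.prems adjacent(1) N(1) by (intro chain_merge[of L P "[B, C]" Q] block_square) (auto simp: N(2) M(2))
    moreover have "length ?Cs < length Bs" by (simp add: adjacent(1))
    ultimately show ?thesis by (intro step[of ?Cs L])
  next
    case empty
    then show ?thesis using shell_empty[of L] by (simp add: shell_def)
  next
    case first
    obtain N where N: "N \<noteq> []" "B = N @ N"
      using nonlinear_block[OF blocks first(3)] by (auto simp: first(2))
    have "chain L ([B] @ Q)" using less.prems first by simp
    note split = chain_split[OF this]
    have "teq False (shell L (concat Bs)) (shell (L @ N) (concat Q))"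
      using shell_square_left[of L N "concat Q"] first N by (simp add: shell_def)
    moreover have "chain (L @ N) Q"
      using split N first(1)
      by (intro chainI) (auto simp: consistent_def)
    ultimately show ?thesis using first(2) by (intro step[of Q "L @ N"]) auto
  next
    case last
    obtain N where N: "N \<noteq> []" "B = N @ N"
      using nonlinear_block[OF blocks last(3)] by (auto simp: last(2))
    have "chain L (P @ [B])" using less.prems last by simp
    note split = chain_split[OF this]
    have "teq False (shell L (concat Bs)) (shell (L @ inv_word N) (concat P))"
      using shell_square_right[of L N "concat P"] last N by (simp add: shell_def)
    moreover have "chain (L @ inv_word N) P"
    proof -
      have "consistent ((L @ concat P) @ N)" "disjoint_words (L @ concat P) N"
        using split by (auto simp: N(2) consistent_def)
      note flipped = consistent_flip_part[OF this]
      have "disjoint_words (L @ inv_word N) (concat P)"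
        using split(2) flipped(2) by auto
      moreover have "consistent ((L @ inv_word N) @ concat P)"
        using flipped(1) unfolding consistent_def set_append by blast
      ultimately show ?thesis using split(3,5) last(1) by (intro chainI) auto
    qed
    ultimately show ?thesis using last(2) by (intro step[of P "L @ inv_word N"]) auto
  qed
qed

lemma reduced_cases:
  assumes "w \<noteq> []"
  shows "(\<exists>L Bs. reduced s L Bs \<and> teq s w (shell L (concat Bs))) \<or> teq s w null_word"
proof (cases s)
  case True
  then show ?thesis using chain_cases[OF assms, of s] by (simp add: reduced_def)
next
  case False
  then show ?thesis
    using chain_cases[OF assms, of s] chain_cases_reduced_False weq_trans by (simp, blast)
qed

abbreviation val :: "(nat \<Rightarrow> tri) \<Rightarrow> letter \<Rightarrow> tri" where
  "val \<equiv> lval tstar"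

lemma val_flip [simp]: "val \<phi> (flip l) = tstar (val \<phi> l)"
  by (cases l) (auto simp: lval_def flip_pair)

lemma tstar_eq_iff [simp]: "tstar a = E \<longleftrightarrow> a = F" "tstar a = F \<longleftrightarrow> a = E" "tstar a = C \<longleftrightarrow> a = C"
  "tstar a = Z \<longleftrightarrow> a = Z"
  by (cases a; simp)+

abbreviation ev :: "bool \<Rightarrow> (nat \<Rightarrow> tri) \<Rightarrow> word \<Rightarrow> tri" where
  "ev s \<equiv> wval (tmul s) tstar"

lemma ev_append: "u \<noteq> [] \<Longrightarrow> v \<noteq> [] \<Longrightarrow> ev s \<phi> (u @ v) = tmul s (ev s \<phi> u) (ev s \<phi> v)"
proof (induction u rule: list_nonempty_induct)
  case (cons l u)
  then show ?case by (simp add: wval_Cons tmul_assoc)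
qed (simp add: wval_Cons)

lemma tmul_eq_E: "tmul s a b = E \<longleftrightarrow> a = E \<and> b = E"
  and tmul_eq_F: "tmul s a b = F \<longleftrightarrow> a = F \<and> b = F"
  and tmul_FC_nonzero: "a \<in> {F, C} \<Longrightarrow> tmul s a b \<noteq> Z \<Longrightarrow> b = F"
  by (cases a; cases b; simp split: if_splits)+

lemma ev_eq_E: "w \<noteq> [] \<Longrightarrow> ev s \<phi> w = E \<longleftrightarrow> (\<forall>x\<in>set w. val \<phi> x = E)"
  and ev_eq_F: "w \<noteq> [] \<Longrightarrow> ev s \<phi> w = F \<longleftrightarrow> (\<forall>x\<in>set w. val \<phi> x = F)"
proof (induction w rule: list_nonempty_induct)
  case (cons x xs)
  {
    case 1 then show ?case using cons by (simp add: wval_Cons tmul_eq_E)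
  next
    case 2 then show ?case using cons by (simp add: wval_Cons tmul_eq_F)
  }
qed simp_all

lemma ev_nonzero_letter: "ev s \<phi> w \<noteq> Z \<Longrightarrow> x \<in> set w \<Longrightarrow> val \<phi> x \<noteq> Z"
proof (induction w)
  case (Cons y w)
  then show ?case by (cases "w = []"; cases "ev s \<phi> w = Z") (auto simp: wval_Cons)
qed simp

lemma ev_nonzero_append: "ev s \<phi> (u @ v) \<noteq> Z \<Longrightarrow> u \<noteq> [] \<Longrightarrow> v \<noteq> [] \<Longrightarrow> ev s \<phi> u \<noteq> Z \<and> ev s \<phi> v \<noteq> Z"
  by (auto simp: ev_append)

text \<open>In a nonzero product nothing but \<open>F\<close> follows a factor \<open>F\<close> or
  \<open>C\<close>. This is the usual reason below why an evaluation vanishes.\<close>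
lemma ev_nonzero_order:
  assumes "ev s \<phi> (p @ x # q @ y # r) \<noteq> Z" and "val \<phi> x \<in> {F, C}"
  shows "val \<phi> y = F"
proof -
  have "ev s \<phi> (x # q @ y # r) \<noteq> Z"
    using assms(1) ev_nonzero_append[of s \<phi> p] by (cases "p = []") auto
  then have "ev s \<phi> (q @ y # r) = F"
    using tmul_FC_nonzero[OF assms(2)] by (simp add: wval_Cons)
  then show ?thesis by (subst (asm) ev_eq_F) auto
qed

lemma ev_nonzero_before:
  assumes "ev s \<phi> (u @ v) \<noteq> Z" and "x \<in> set u" and "y \<in> set v" and "val \<phi> x \<in> {F, C}"
  shows "val \<phi> y = F"
proof -
  obtain p q where u: "u = p @ x # q" using assms(2) by (auto dest: split_list)
  obtain p' q' where v: "v = p' @ y # q'" using assms(3) by (auto dest: split_list)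
  show ?thesis using ev_nonzero_order[of s \<phi> p x "q @ p'" y q'] assms(1,4) by (simp add: u v)
qed

lemma ev_pivot:
  assumes "\<forall>x\<in>set u. val \<phi> x = E" and "val \<phi> x = C" and "\<forall>x\<in>set v. val \<phi> x = F"
  shows "ev s \<phi> (u @ x # v) = C"
proof -
  have "ev s \<phi> (x # v) = C"
    using assms(2,3) ev_eq_F[of v s \<phi>] by (cases "v = []") (auto simp: wval_Cons)
  then show ?thesis
    using assms(1) ev_eq_E[of u s \<phi>] by (cases "u = []") (auto simp: ev_append)
qed

lemma ev_split_nonzero:
  assumes "\<forall>x\<in>set u. val \<phi> x = E" and "\<forall>x\<in>set v. val \<phi> x = F" and "u @ v \<noteq> []"
    and "s \<or> u = [] \<or> v = []"
  shows "ev s \<phi> (u @ v) \<noteq> Z"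
proof -
  have "u = [] \<or> ev s \<phi> u = E" "v = [] \<or> ev s \<phi> v = F"
    using assms(1,2) ev_eq_E[of u s \<phi>] ev_eq_F[of v s \<phi>] by blast+
  then show ?thesis using assms(3,4) by (cases "u = []"; cases "v = []") (auto simp: ev_append)
qed

definition assign :: "letter set \<Rightarrow> nat set \<Rightarrow> nat \<Rightarrow> tri" where
  "assign A K n = (if n \<in> K then C else if (n, False) \<in> A then E else if (n, True) \<in> A then F else Z)"

lemma val_assign:
  "fst l \<in> K \<Longrightarrow> val (assign A K) l = C"
  "fst l \<notin> K \<Longrightarrow> l \<in> A \<Longrightarrow> flip l \<notin> A \<Longrightarrow> val (assign A K) l = E"
  "fst l \<notin> K \<Longrightarrow> l \<notin> A \<Longrightarrow> flip l \<in> A \<Longrightarrow> val (assign A K) l = F"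
  by (cases l; cases "snd l"; simp add: lval_def assign_def flip_pair)+

lemma exists_assignment:
  assumes "consistent (u @ k @ v)" and "disjoint_words u v" and "disjoint_words (u @ v) k"
  shows "\<exists>\<phi>. (\<forall>x\<in>set u. val \<phi> x = E) \<and> (\<forall>x\<in>set v. val \<phi> x = F) \<and> (\<forall>x\<in>set k. val \<phi> x = C)"
proof (intro exI conjI ballI)
  let ?\<phi> = "assign (set u \<union> flip ` set v) (fst ` set k)"
  have K: "fst x \<notin> fst ` set k" if "x \<in> set (u @ v)" for x
  proof
    assume "fst x \<in> fst ` set k"
    then obtain y where y: "y \<in> set k" "fst x = fst y" by auto
    have "x \<noteq> y" using y(1) that assms(3) by blast
    moreover have "x \<noteq> flip y" using y(1) that assms(1) by (auto simp: consistent_def)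
    ultimately show False using same_variable[OF y(2)] by blast
  qed
  show "val ?\<phi> x = E" if "x \<in> set u" for x
  proof -
    have "x \<notin> set v" using that assms(2) by blast
    then show ?thesis using that K[of x] assms(1)
      by (intro val_assign(2)) (auto simp: consistent_def in_flip_image)
  qed
  show "val ?\<phi> x = F" if "x \<in> set v" for x
  proof -
    have "x \<notin> set u" using that assms(2) by blast
    then show ?thesis using that K[of x] assms(1)
      by (intro val_assign(3)) (auto simp: consistent_def in_flip_image)
  qed
  show "val ?\<phi> x = C" if "x \<in> set k" for x
    using that by (intro val_assign(1)) auto
qed

text \<open>A cut between two blocks. For \<open>s\<close> false the product \<open>E F\<close> is
  zero, and the cut must be at the very beginning or end of a word without shell.\<close>
lemma shell_split_nonzero:
  assumes "chain L (P @ Q)" and "s \<or> L @ concat P = [] \<or> L = [] \<and> concat Q = []"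
  shows "\<exists>\<phi>. ev s \<phi> (shell L (concat (P @ Q))) \<noteq> Z \<and>
    (\<forall>x\<in>set (L @ concat P). val \<phi> x = E) \<and> (\<forall>x\<in>set (concat Q). val \<phi> x = F)"
proof -
  note split = chain_split[OF assms(1)]
  have "consistent ((L @ concat P) @ [] @ concat Q)" "disjoint_words (L @ concat P) (concat Q)"
    "disjoint_words ((L @ concat P) @ concat Q) []"
    using split by simp_all
  from exists_assignment[OF this] obtain \<phi> where
    E: "\<forall>x\<in>set (L @ concat P). val \<phi> x = E" and F: "\<forall>x\<in>set (concat Q). val \<phi> x = F" by blast
  have "\<exists>B\<in>set (P @ Q). B \<noteq> []" if "L = []"
    using assms(1) that block_nonempty unfolding chain_def by (cases "P @ Q") (auto simp del: append_eq_Cons_conv)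
  then have "(L @ concat P) @ (concat Q @ inv_word L) \<noteq> []" by auto
  then have "ev s \<phi> ((L @ concat P) @ (concat Q @ inv_word L)) \<noteq> Z"
    using E F assms(2) by (intro ev_split_nonzero) (auto simp: in_flip_image)
  then show ?thesis using E F by (auto simp: shell_def)
qed

text \<open>A cut through a linear block, whose letter takes the value \<open>C\<close>.\<close>
lemma shell_pivot_nonzero:
  assumes "chain L (P @ [x] # Q)"
  shows "\<exists>\<phi>. ev s \<phi> (shell L (concat (P @ [x] # Q))) \<noteq> Z \<and> val \<phi> x = C \<and>
    (\<forall>y\<in>set (L @ concat P). val \<phi> y = E) \<and> (\<forall>y\<in>set (concat Q). val \<phi> y = F)"
proof -
  have "chain L ((P @ [[x]]) @ Q)" using assms by simp
  note split = chain_split[OF this] chain_split[OF assms]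
  have "consistent ((L @ concat P) @ [x] @ concat Q)" using split(6) by simp
  moreover have "disjoint_words (L @ concat P) (concat Q)" using split(7) by auto
  moreover have "disjoint_words ((L @ concat P) @ concat Q) [x]" using split(1,7) by auto
  ultimately have "\<exists>\<phi>. (\<forall>y\<in>set (L @ concat P). val \<phi> y = E) \<and> (\<forall>y\<in>set (concat Q). val \<phi> y = F) \<and>
      (\<forall>y\<in>set [x]. val \<phi> y = C)"
    by (rule exists_assignment)
  then obtain \<phi> where E: "\<forall>y\<in>set (L @ concat P). val \<phi> y = E"
    and F: "\<forall>y\<in>set (concat Q). val \<phi> y = F" and C: "val \<phi> x = C" by auto
  have "ev s \<phi> ((L @ concat P) @ x # (concat Q @ inv_word L)) = C"
    using E F C by (intro ev_pivot) (auto simp: in_flip_image)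
  then have "ev s \<phi> (shell L (concat (P @ [x] # Q))) \<noteq> Z" by (simp add: shell_def)
  then show ?thesis using E F C by (intro exI[of _ \<phi>]) simp
qed

lemma linear_letter: "linear B \<Longrightarrow> \<exists>x. B = [x]"
  by (cases B) auto

text \<open>The first cut in the chain of a reduced word; it separates letters of the shell from
  letters of the core, as none of the latter is \<open>E\<close>.\<close>
lemma reduced_bottom:
  assumes "reduced s L Bs"
  shows "\<exists>\<phi>. ev s \<phi> (shell L (concat Bs)) \<noteq> Z \<and> (\<forall>x\<in>set L. val \<phi> x = E) \<and>
    (\<forall>x\<in>set (concat Bs). val \<phi> x \<in> {F, C})"
proof (cases "s \<or> L = []")
  case True
  moreover have "chain L ([] @ Bs)" using assms by (simp add: reduced_def)
  ultimately have "\<exists>\<phi>. ev s \<phi> (shell L (concat Bs)) \<noteq> Z \<and> (\<forall>x\<in>set L. val \<phi> x = E) \<and>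
      (\<forall>x\<in>set (concat Bs). val \<phi> x = F)"
    using shell_split_nonzero[of L "[]" Bs s] by auto
  then show ?thesis by blast
next
  case False
  then have "Bs \<noteq> []" "linear (hd Bs)" using assms by (auto simp: reduced_def)
  then obtain x where "hd Bs = [x]" using linear_letter by blast
  then have Bs: "Bs = [] @ [x] # tl Bs" using \<open>Bs \<noteq> []\<close> by (cases Bs) auto
  then have "chain L ([] @ [x] # tl Bs)" using assms by (simp add: reduced_def)
  from shell_pivot_nonzero[OF this, of s] show ?thesis
    unfolding Bs[symmetric] by (subst (2) Bs) auto
qed

lemma reduced_top:
  assumes "reduced s L Bs"
  shows "\<exists>\<phi>. ev s \<phi> (shell L (concat Bs)) \<noteq> Z \<and> (\<forall>x\<in>set L. val \<phi> x = E) \<and>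
    (\<forall>x\<in>set (concat Bs). val \<phi> x \<in> {E, C})"
proof (cases "s \<or> L = []")
  case True
  moreover have "chain L (Bs @ [])" using assms by (simp add: reduced_def)
  ultimately have "\<exists>\<phi>. ev s \<phi> (shell L (concat Bs)) \<noteq> Z \<and> (\<forall>x\<in>set L. val \<phi> x = E) \<and>
      (\<forall>x\<in>set (concat Bs). val \<phi> x = E)"
    using shell_split_nonzero[of L Bs "[]" s] by (simp add: ball_Un) blast
  then show ?thesis by blast
next
  case False
  then have "Bs \<noteq> []" "linear (last Bs)" using assms by (auto simp: reduced_def)
  then obtain x where "last Bs = [x]" using linear_letter by blast
  then have Bs: "Bs = butlast Bs @ [x] # []" using \<open>Bs \<noteq> []\<close> by (metis append_butlast_last_id)
  then have "chain L (butlast Bs @ [x] # [])" using assms by (simp add: reduced_def)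
  from shell_pivot_nonzero[OF this, of s] show ?thesis
    unfolding Bs[symmetric] by (subst (2) Bs) auto
qed

section \<open>Chains are determined by the identities they satisfy\<close>

text \<open>The order of the blocks, seen as a strict order on letters.\<close>
primrec before :: "'b set list \<Rightarrow> 'b \<Rightarrow> 'b \<Rightarrow> bool" where
  "before [] x y \<longleftrightarrow> False"
| "before (A # As) x y \<longleftrightarrow> x \<in> A \<and> y \<in> \<Union> (set As) \<or> before As x y"

lemma before_mem: "before As x y \<Longrightarrow> x \<in> \<Union> (set As) \<and> y \<in> \<Union> (set As)"
  by (induction As) auto

lemma before_total:
  "x \<in> \<Union> (set As) \<Longrightarrow> y \<in> \<Union> (set As) \<Longrightarrow> before As x y \<or> before As y x \<or> (\<exists>A\<in>set As. x \<in> A \<and> y \<in> A)"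
  by (induction As) auto

lemma before_split:
  "before (map set Bs) x y \<Longrightarrow> \<exists>P B Q. Bs = P @ B # Q \<and> x \<in> set B \<and> y \<in> set (concat Q)"
proof (induction Bs)
  case (Cons B Bs)
  show ?case
  proof (cases "before (map set Bs) x y")
    case True
    then show ?thesis using Cons.IH by (metis append_Cons)
  next
    case False
    then show ?thesis using Cons.prems by (intro exI[of _ "[]"] exI[of _ B] exI[of _ Bs]) auto
  qed
qed simp

text \<open>The first set consists of the elements that nothing precedes, and removing it from the
  list removes it from the order.\<close>
lemma before_determines:
  assumes "sorted_wrt (\<lambda>A B. A \<inter> B = {}) As" and "sorted_wrt (\<lambda>A B. A \<inter> B = {}) Cs"
    and "{} \<notin> set As" and "{} \<notin> set Cs"
    and "\<Union> (set As) = \<Union> (set Cs)" and "before As = before Cs"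
  shows "As = Cs"
  using assms
proof (induction As arbitrary: Cs)
  case Nil
  then show ?case by (cases Cs) auto
next
  case (Cons A As)
  then obtain C Cs' where Cs: "Cs = C # Cs'" by (cases Cs) auto
  have first: "D = {x \<in> \<Union> (set (D # Ds)). \<forall>y. \<not> before (D # Ds) y x}"
    if "sorted_wrt (\<lambda>A B. A \<inter> B = {}) (D # Ds)" "{} \<notin> set (D # Ds)" for D and Ds :: "'a set list"
    using that before_mem by (fastforce simp: disjoint_iff)
  have "A = C" using first[of A As] first[of C Cs'] Cons.prems unfolding Cs by metis
  moreover have "As = Cs'"
  proof (rule Cons.IH)
    have restrict: "before Ds = (\<lambda>x y. before (D # Ds) x y \<and> x \<notin> D)"
      if "sorted_wrt (\<lambda>A B. A \<inter> B = {}) (D # Ds)" for D and Ds :: "'a set list"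
      using that before_mem by (fastforce simp: disjoint_iff fun_eq_iff)
    show "before As = before Cs'"
      using restrict[of A As] restrict[of C Cs'] Cons.prems \<open>A = C\<close> unfolding Cs by metis
    have "\<Union> (set Ds) = \<Union> (set (D # Ds)) - D"
      if "sorted_wrt (\<lambda>A B. A \<inter> B = {}) (D # Ds)" for D and Ds :: "'a set list"
      using that by auto
    then show "\<Union> (set As) = \<Union> (set Cs')"
      using Cons.prems \<open>A = C\<close> unfolding Cs by metis
  qed (use Cons.prems in \<open>auto simp: Cs\<close>)
  ultimately show ?case by (simp add: Cs)
qed

text \<open>Cut behind the block of \<open>x\<close> if the product \<open>E F\<close> is nonzero.
  Otherwise the block of \<open>x\<close> or the next one is linear, and the cut goes through
  it.\<close>
lemma before_nonzero:
  assumes red: "reduced s L Bs" and "before (map set Bs) x y"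
  shows "\<exists>\<phi>. ev s \<phi> (shell L (concat Bs)) \<noteq> Z \<and> val \<phi> x \<in> {E, C} \<and> val \<phi> y \<in> {F, C}"
proof -
  obtain P B Q where Bs: "Bs = P @ B # Q" and x: "x \<in> set B" and y: "y \<in> set (concat Q)"
    using before_split[OF assms(2)] by blast
  have chain: "chain L Bs" using red by (simp add: reduced_def)
  consider "s" | z where "B = [z]" | z R where "Q = [z] # R"
  proof -
    assume *: "s \<Longrightarrow> thesis" "\<And>z. B = [z] \<Longrightarrow> thesis" "\<And>z R. Q = [z] # R \<Longrightarrow> thesis"
    obtain D R where Q: "Q = D # R" using y by (cases Q) auto
    have "s \<or> linear B \<or> linear D" using red Bs Q unfolding reduced_def by blast
    then show thesis using * Q linear_letter by metis
  qed
  then show ?thesis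
  proof cases
    case 1
    have Bs': "Bs = (P @ [B]) @ Q" by (simp add: Bs)
    have "chain L ((P @ [B]) @ Q)" using chain by (simp add: Bs)
    from shell_split_nonzero[OF this, of s] 1 obtain \<phi> where
      \<phi>: "ev s \<phi> (shell L (concat Bs)) \<noteq> Z" "\<forall>x\<in>set (L @ concat (P @ [B])). val \<phi> x = E"
        "\<forall>x\<in>set (concat Q). val \<phi> x = F" unfolding Bs' by blast
    have "val \<phi> x = E" using \<phi>(2) x by simp
    moreover have "val \<phi> y = F" using \<phi>(3) y by blast
    ultimately show ?thesis using \<phi>(1) by blast
  next
    case 2
    have "chain L (P @ [z] # Q)" using chain by (simp add: Bs 2)
    from shell_pivot_nonzero[OF this, of s] obtain \<phi> where
      \<phi>: "ev s \<phi> (shell L (concat Bs)) \<noteq> Z" "val \<phi> z = C"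
        "\<forall>x\<in>set (concat Q). val \<phi> x = F" unfolding Bs 2 by blast
    have "val \<phi> x = C" using \<phi>(2) x 2 by simp
    moreover have "val \<phi> y = F" using \<phi>(3) y by blast
    ultimately show ?thesis using \<phi>(1) by blast
  next
    case 3
    have Bs': "Bs = (P @ [B]) @ [z] # R" by (simp add: Bs 3)
    have "chain L ((P @ [B]) @ [z] # R)" using chain by (simp add: Bs 3)
    from shell_pivot_nonzero[OF this, of s] obtain \<phi> where
      \<phi>: "ev s \<phi> (shell L (concat Bs)) \<noteq> Z" "val \<phi> z = C"
        "\<forall>x\<in>set (L @ concat (P @ [B])). val \<phi> x = E"
        "\<forall>x\<in>set (concat R). val \<phi> x = F" unfolding Bs' by blast
    have "val \<phi> x = E" using \<phi>(3) x by simp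
    moreover have "val \<phi> y \<in> {F, C}" using \<phi>(2,4) y 3 by auto
    ultimately show ?thesis using \<phi>(1) by blast
  qed
qed

text \<open>The star of \<open>x\<close> comes later in the word, and the values \<open>F\<close>
  and \<open>C\<close> for \<open>x\<close> would give it the value \<open>E\<close> or
  \<open>C\<close>, which is impossible behind \<open>F\<close> or \<open>C\<close>.\<close>
lemma shell_letter_E:
  assumes "ev s \<phi> (shell L r) \<noteq> Z" and "x \<in> set L"
  shows "val \<phi> x = E"
proof -
  have "ev s \<phi> (L @ (r @ inv_word L)) \<noteq> Z" using assms by (simp add: shell_def)
  moreover have "flip x \<in> set (r @ inv_word L)" using assms(2) by simp
  ultimately have "val \<phi> x \<in> {F, C} \<Longrightarrow> val \<phi> (flip x) = F"
    using ev_nonzero_before assms(2) by blast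
  moreover have "val \<phi> x \<noteq> Z" using assms(2) by (intro ev_nonzero_letter[OF assms(1)]) (simp add: shell_def)
  ultimately show ?thesis by (cases "val \<phi> x") auto
qed

lemma shell_core_order:
  assumes "ev s \<phi> (shell L r) \<noteq> Z" and "r = p @ x # q @ y # t" and "val \<phi> x \<in> {F, C}"
  shows "val \<phi> y = F"
  using assms ev_nonzero_order[of s \<phi> "L @ p" x q y "t @ inv_word L"] by (simp add: shell_def)

lemma before_positions:
  "before (map set Bs) x y \<Longrightarrow> \<exists>p q t. concat Bs = p @ x # q @ y # t"
proof -
  assume bef: "before (map set Bs) x y"
  obtain P B Q where Bs: "Bs = P @ B # Q" and x: "x \<in> set B" and y: "y \<in> set (concat Q)"
    using before_split[OF bef] by blast
  obtain a b where "B = a @ x # b" using split_list[OF x] by blast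
  moreover obtain c d where "concat Q = c @ y # d" using split_list[OF y] by blast
  ultimately have "concat Bs = (concat P @ a) @ x # (b @ c) @ y # d" by (simp add: Bs)
  then show ?thesis by blast
qed

lemma block_positions:
  assumes "block D" and "x \<in> set D" and "y \<in> set D" and "x \<noteq> y"
  shows "\<exists>p q t. D = p @ x # q @ y # t"
proof -
  have "\<not> linear D" using assms(2-4) linear_letter by fastforce
  then obtain N where N: "D = N @ N" using nonlinear_block[OF assms(1)] by blast
  have xy: "x \<in> set N" "y \<in> set N" using assms(2,3) N by auto
  obtain a b where a: "N = a @ x # b" using split_list[OF xy(1)] by blast
  obtain c d where c: "N = c @ y # d" using split_list[OF xy(2)] by blast
  have "D = a @ x # (b @ c) @ y # d" using a c N by simp
  then show ?thesis by blast
qed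

text \<open>An evaluation that cuts between \<open>x\<close> and \<open>y\<close> vanishes on any
  core in which \<open>y\<close> has an occurrence before one of \<open>x\<close>, and that is the
  case unless \<open>x\<close> stands in an earlier block.\<close>
lemma before_transfer:
  assumes red: "reduced s L Bs" "reduced s M Cs"
    and agree: "\<And>\<phi>. ev s \<phi> (shell L (concat Bs)) = ev s \<phi> (shell M (concat Cs))"
    and sub: "set (concat Bs) \<subseteq> set (concat Cs)" and bef: "before (map set Bs) x y"
  shows "before (map set Cs) x y"
proof (rule ccontr)
  assume not: "\<not> before (map set Cs) x y"
  obtain \<phi> where \<phi>: "ev s \<phi> (shell M (concat Cs)) \<noteq> Z" "val \<phi> x \<in> {E, C}" "val \<phi> y \<in> {F, C}"
    using before_nonzero[OF red(1) bef] agree by metis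
  have "x \<noteq> y"
  proof
    assume "x = y"
    obtain P B Q where split: "Bs = P @ B # Q" "x \<in> set B" "y \<in> set (concat Q)"
      using before_split[OF bef] by blast
    then have "chain L ((P @ [B]) @ Q)" using red(1) by (simp add: reduced_def)
    from chain_split(1)[OF this] show False using split(2,3) \<open>x = y\<close> by auto
  qed
  have mem: "x \<in> \<Union> (set (map set Cs))" "y \<in> \<Union> (set (map set Cs))"
    using before_mem[OF bef] sub by auto
  have "\<exists>p q t. concat Cs = p @ y # q @ x # t"
  proof (cases "before (map set Cs) y x")
    case True
    then show ?thesis by (rule before_positions)
  next
    case False
    then obtain D where D: "D \<in> set Cs" "x \<in> set D" "y \<in> set D"
      using before_total[OF mem] not by auto
    have "block D" using red(2) D(1) by (auto simp: reduced_def chain_def)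
    from block_positions[OF this D(3,2)] \<open>x \<noteq> y\<close> obtain p q t where "D = p @ y # q @ x # t" by auto
    moreover obtain P Q where "Cs = P @ D # Q" using split_list[OF D(1)] by blast
    ultimately have "concat Cs = (concat P @ p) @ y # q @ x # (t @ concat Q)" by simp
    then show ?thesis by blast
  qed
  then obtain p q t where "concat Cs = p @ y # q @ x # t" by blast
  from shell_core_order[OF \<phi>(1) this \<phi>(3)] \<phi>(2) show False by auto
qed

text \<open>A square contains each of its letters twice, but only one factor of a nonzero product
  can be \<open>C\<close>.\<close>
lemma linear_transfer:
  assumes red: "reduced s L Bs" "reduced s M Cs"
    and agree: "\<And>\<phi>. ev s \<phi> (shell L (concat Bs)) = ev s \<phi> (shell M (concat Cs))"
    and "B \<in> set Bs" "D \<in> set Cs" "set B = set D" "linear B"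
  shows "linear D"
proof (rule ccontr)
  assume nonlin: "\<not> linear D"
  obtain x where x: "B = [x]" using assms(7) linear_letter by blast
  obtain P Q where Bs: "Bs = P @ [x] # Q" using split_list[OF assms(4)] x by blast
  then obtain \<phi> where \<phi>: "ev s \<phi> (shell M (concat Cs)) \<noteq> Z" "val \<phi> x = C"
    using shell_pivot_nonzero[of L P x Q s] red(1) agree unfolding reduced_def Bs by metis
  have "block D" using red(2) assms(5) by (auto simp: reduced_def chain_def)
  then obtain N where N: "D = N @ N" using nonlin nonlinear_block by blast
  have "x \<in> set N" using assms(6) x N by auto
  then obtain a b where a: "N = a @ x # b" using split_list by metis
  obtain P Q where "Cs = P @ D # Q" using split_list[OF assms(5)] by blast
  then have "concat Cs = (concat P @ a) @ x # (b @ a) @ x # (b @ concat Q)" by (simp add: N a)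
  from shell_core_order[OF \<phi>(1) this] \<phi>(2) show False by auto
qed

lemma concat_blocks_cong:
  assumes "map set Bs = map set Cs" and "\<forall>B\<in>set (Bs @ Cs). block B"
    and "\<forall>B\<in>set Bs. \<forall>D\<in>set Cs. set B = set D \<longrightarrow> (linear B \<longleftrightarrow> linear D)"
  shows "teq s (concat Bs) (concat Cs)"
  using assms
proof (induction Bs arbitrary: Cs)
  case (Cons B Bs)
  then obtain D Ds where Cs: "Cs = D # Ds" "set B = set D" "map set Bs = map set Ds" by auto
  have lin: "linear B \<longleftrightarrow> linear D" using Cons.prems Cs by auto
  have "teq s B D"
  proof (cases "linear B")
    case True
    then obtain x y where "B = [x]" "D = [y]" using lin linear_letter by metis
    then show ?thesis using Cs(2) by simp
  next
    case False
    obtain N where N: "N \<noteq> []" "B = N @ N" using nonlinear_block[OF _ False] Cons.prems by auto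
    obtain M where M: "D = M @ M" using nonlinear_block[of D] False lin Cons.prems Cs by auto
    show ?thesis using square_cong[of N M s] N M Cs(2) by simp
  qed
  moreover have "teq s (concat Bs) (concat Ds)"
    using Cons.prems Cs by (intro Cons.IH) auto
  ultimately show ?case by (simp add: Cs(1) weq_append)
qed simp

lemma reduced_unique_aligned:
  assumes red: "reduced s L Bs" "reduced s M Cs"
    and agree: "\<And>\<phi>. ev s \<phi> (shell L (concat Bs)) = ev s \<phi> (shell M (concat Cs))"
    and sets: "set L = set M" "set (concat Bs) = set (concat Cs)"
  shows "teq s (shell L (concat Bs)) (shell M (concat Cs))"
proof -
  have chain: "chain L Bs" "chain M Cs" using red by (auto simp: reduced_def)
  have ne: "{} \<notin> set (map set Ds)" if "chain K Ds" for K Ds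
    using that block_nonempty by (auto simp: chain_def)
  have sorted: "sorted_wrt (\<lambda>A B. A \<inter> B = {}) (map set Ds)" if "chain K Ds" for K Ds
    using that by (simp add: chain_def sorted_wrt_map)
  have "map set Bs = map set Cs"
  proof (rule before_determines)
    show "before (map set Bs) = before (map set Cs)"
      using before_transfer[OF red agree] before_transfer[OF red(2,1) agree[symmetric]] sets(2)
      by (intro ext iffI) auto
  qed (use sorted ne chain sets in auto)
  moreover have "\<forall>B\<in>set Bs. \<forall>D\<in>set Cs. set B = set D \<longrightarrow> (linear B \<longleftrightarrow> linear D)"
    using linear_transfer[OF red agree] linear_transfer[OF red(2,1) agree[symmetric]] by metis
  ultimately have "teq s (concat Bs) (concat Cs)"
    using chain by (intro concat_blocks_cong) (auto simp: chain_def)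
  then have "teq s (shell L (concat Bs)) (shell L (concat Cs))" by (rule shell_cong)
  also have "teq s \<dots> (shell M (concat Cs))" using sets(1) by (rule shell_set_cong)
  finally show ?thesis .
qed

text \<open>Inside a nonempty shell the core may be replaced by its inverse; this is the only
  ambiguity of reduced chains beyond permuting and repeating letters in \<open>L\<close> and in
  squares.\<close>
definition reverse_core :: "word list \<Rightarrow> word list" where
  "reverse_core Bs = rev (map inv_word Bs)"

lemma concat_reverse_core: "concat (reverse_core Bs) = inv_word (concat Bs)"
  by (induction Bs) (auto simp: reverse_core_def)

lemma reverse_core_append: "reverse_core (P @ Q) = reverse_core Q @ reverse_core P"
  and reverse_core_Cons: "reverse_core (B # Q) = reverse_core Q @ [inv_word B]"
  and reverse_core_twice: "reverse_core (reverse_core Bs) = Bs"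
  by (auto simp: reverse_core_def rev_map comp_def)

lemma block_inv_word: "block B \<Longrightarrow> block (inv_word B)"
  unfolding block_def
proof (elim disjE exE conjE)
  fix N assume "N \<noteq> []" "B = N @ N"
  then show "(\<exists>x. inv_word B = [x]) \<or> (\<exists>N. N \<noteq> [] \<and> inv_word B = N @ N)"
    by (intro disjI2 exI[of _ "inv_word N"]) simp
qed simp

lemma disjoint_inv_word: "disjoint_words (inv_word u) (inv_word v) \<longleftrightarrow> disjoint_words v u"
proof -
  have "flip ` A \<inter> flip ` B = flip ` (A \<inter> B)" for A B
    by (auto simp: in_flip_image)
  then show ?thesis by auto
qed

lemma chain_reverse:
  assumes "chain L Bs" and "L \<noteq> []"
  shows "chain L (reverse_core Bs)"
proof (rule chainI)
  show "\<And>B. B \<in> set (reverse_core Bs) \<Longrightarrow> block B"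
    using assms(1) block_inv_word by (auto simp: reverse_core_def chain_def)
  have "sorted_wrt disjoint_words Bs" using assms(1) by (simp add: chain_def)
  then show "sorted_wrt disjoint_words (reverse_core Bs)"
    unfolding reverse_core_def sorted_wrt_rev sorted_wrt_map disjoint_inv_word .
  have "chain L (Bs @ [])" using assms(1) by simp
  note split = chain_split[OF this]
  have "consistent (L @ concat Bs)" "disjoint_words L (concat Bs)" using split by simp_all
  from consistent_flip_part[OF this]
  show "disjoint_words L (concat (reverse_core Bs))" "consistent (L @ concat (reverse_core Bs))"
    by (simp_all only: concat_reverse_core)
qed (use assms in simp)

lemma reduced_reverse:
  assumes "reduced s L Bs" and "L \<noteq> []"
  shows "reduced s L (reverse_core Bs)"
  unfolding reduced_def
proof (intro conjI impI allI)
  show "chain L (reverse_core Bs)" using assms by (simp add: chain_reverse reduced_def)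
  assume s: "\<not> s"
  have lin: "linear (inv_word B) \<longleftrightarrow> linear B" for B by simp
  show "linear B \<or> linear D" if "reverse_core Bs = P @ B # D # Q" for P B D Q
  proof -
    have "Bs = reverse_core Q @ inv_word D # inv_word B # reverse_core P"
      using arg_cong[OF that, of reverse_core] by (simp add: reverse_core_twice reverse_core_append reverse_core_Cons)
    then have "linear (inv_word D) \<or> linear (inv_word B)"
      using assms s unfolding reduced_def by blast
    then show ?thesis by auto
  qed
  have "Bs \<noteq> []" "linear (hd Bs)" "linear (last Bs)" using assms s by (auto simp: reduced_def)
  then show "reverse_core Bs \<noteq> []" "linear (hd (reverse_core Bs))" "linear (last (reverse_core Bs))"
    by (auto simp: reverse_core_def hd_rev last_rev last_map hd_map)
qed

lemma teq_reverse:
  assumes "L \<noteq> []"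
  shows "teq s (shell L r) (shell L (inv_word r))"
  using shell_reverse[of r L s] assms by (cases "r = []") (auto simp: shell_def)

lemma reduced_nonempty: "chain L Bs \<Longrightarrow> shell L (concat Bs) \<noteq> []"
  using block_nonempty by (cases Bs) (auto simp: chain_def shell_def)

text \<open>A variable of \<open>v\<close> that is missing in \<open>u\<close> can be set to zero
  without changing the value of \<open>u\<close>.\<close>
lemma agree_variables:
  assumes "u \<noteq> []" and "ev s \<phi> u \<noteq> Z" and agree: "\<And>\<phi>. ev s \<phi> u = ev s \<phi> v"
  shows "fst ` set v \<subseteq> fst ` set u"
proof
  fix n assume "n \<in> fst ` set v"
  then obtain l where l: "l \<in> set v" "n = fst l" by blast
  define \<psi> where "\<psi> n = (if n \<in> fst ` set u then \<phi> n else Z)" for n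
  have "ev s \<psi> u = ev s \<phi> u" using assms(1) by (intro wval_cong) (auto simp: \<psi>_def)
  then have "ev s \<psi> v \<noteq> Z" using assms(2) agree by metis
  from ev_nonzero_letter[OF this l(1)] have "\<psi> n \<noteq> Z" by (auto simp: lval_def l(2) split: if_splits)
  then show "n \<in> fst ` set u" unfolding \<psi>_def by (meson)
qed

lemma reduced_agree_variables:
  assumes "reduced s L Bs" and "\<And>\<phi>. ev s \<phi> (shell L (concat Bs)) = ev s \<phi> v" and "x \<in> set v"
  shows "x \<in> set (L @ concat Bs) \<or> flip x \<in> set (L @ concat Bs)"
proof -
  obtain \<phi> where "ev s \<phi> (shell L (concat Bs)) \<noteq> Z" using reduced_bottom[OF assms(1)] by blast
  moreover have "shell L (concat Bs) \<noteq> []" using assms(1) by (simp add: reduced_def reduced_nonempty)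
  ultimately have "fst ` set v \<subseteq> fst ` set (shell L (concat Bs))"
    using agree_variables assms(2) by blast
  then obtain y where y: "y \<in> set (shell L (concat Bs))" "fst x = fst y" using assms(3) by force
  then show ?thesis using same_variable[OF y(2)] by (auto simp: shell_def in_flip_image)
qed

text \<open>Without a shell, the assignment that is constantly \<open>E\<close> on the letters of
  the first word gives the value \<open>E\<close>, which no word with a shell attains and which
  reveals the sign of every letter.\<close>
lemma plain_letters:
  assumes red: "reduced s [] Bs" "reduced s M Cs"
    and agree: "\<And>\<phi>. ev s \<phi> (shell [] (concat Bs)) = ev s \<phi> (shell M (concat Cs))"
  shows "M = []" and "set (concat Cs) \<subseteq> set (concat Bs)"
proof -
  have "consistent (concat Bs @ [] @ [])" using red(1) by (simp add: reduced_def chain_def)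
  from exists_assignment[OF this] obtain \<phi> where E: "\<forall>x\<in>set (concat Bs). val \<phi> x = E" by auto
  have ne: "shell [] (concat Bs) \<noteq> []" "shell M (concat Cs) \<noteq> []"
    using red by (simp_all add: reduced_def reduced_nonempty)
  have "ev s \<phi> (shell [] (concat Bs)) = E"
    using E ev_eq_E[OF ne(1)] by (simp add: shell_def)
  then have "ev s \<phi> (shell M (concat Cs)) = E" by (simp add: agree)
  then have E': "\<forall>x\<in>set (shell M (concat Cs)). val \<phi> x = E" using ev_eq_E[OF ne(2)] by blast
  show "M = []"
  proof (rule ccontr)
    assume "M \<noteq> []"
    then have "hd M \<in> set (shell M (concat Cs))" "flip (hd M) \<in> set (shell M (concat Cs))"
      by (auto simp: shell_def)
    then have "val \<phi> (hd M) = E" "val \<phi> (flip (hd M)) = E" using E' by blast+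
    then show False by simp
  qed
  show "set (concat Cs) \<subseteq> set (concat Bs)"
  proof
    fix x assume x: "x \<in> set (concat Cs)"
    then have x': "x \<in> set (shell M (concat Cs))" by (simp add: shell_def)
    have "flip x \<notin> set (concat Bs)"
    proof
      assume "flip x \<in> set (concat Bs)"
      then have "val \<phi> (flip x) = E" using E by blast
      moreover have "val \<phi> x = E" using E' x' by blast
      ultimately show False by simp
    qed
    then show "x \<in> set (concat Bs)" using reduced_agree_variables[OF red(1) agree x'] by simp
  qed
qed

text \<open>A letter of the shell is \<open>E\<close> in all nonzero evaluations, whereas letters
  of the core are not \<open>E\<close> at the first cut and not \<open>F\<close> at the last
  one.\<close>
lemma shell_letters:
  assumes red: "reduced s L Bs" "reduced s M Cs"
    and agree: "\<And>\<phi>. ev s \<phi> (shell L (concat Bs)) = ev s \<phi> (shell M (concat Cs))"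
  shows "set L \<subseteq> set M"
proof
  fix x assume x: "x \<in> set L"
  have E: "val \<phi> x = E" if "ev s \<phi> (shell M (concat Cs)) \<noteq> Z" for \<phi>
    using shell_letter_E[OF _ x] that agree by metis
  obtain \<phi> where \<phi>: "ev s \<phi> (shell M (concat Cs)) \<noteq> Z" "\<forall>x\<in>set M. val \<phi> x = E"
    "\<forall>x\<in>set (concat Cs). val \<phi> x \<in> {F, C}"
    using reduced_bottom[OF red(2)] by blast
  obtain \<psi> where \<psi>: "ev s \<psi> (shell M (concat Cs)) \<noteq> Z" "\<forall>x\<in>set M. val \<psi> x = E"
    "\<forall>x\<in>set (concat Cs). val \<psi> x \<in> {E, C}"
    using reduced_top[OF red(2)] by blast
  have "val \<phi> x = E" "val \<psi> x = E" using E \<phi>(1) \<psi>(1) by auto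
  then have "flip x \<notin> set M" "x \<notin> set (concat Cs)" "flip x \<notin> set (concat Cs)"
    using \<phi>(2,3) \<psi>(3) by force+
  moreover have mem: "x \<in> set (shell L (concat Bs))" using x by (simp add: shell_def)
  ultimately show "x \<in> set M"
    using reduced_agree_variables[OF red(2) agree[symmetric] mem] by auto
qed

lemma core_letters:
  assumes red: "reduced s L Bs" "reduced s M Cs"
    and agree: "\<And>\<phi>. ev s \<phi> (shell L (concat Bs)) = ev s \<phi> (shell M (concat Cs))"
    and LM: "set L = set M" and y: "y \<in> set (concat Bs)"
  shows "y \<in> set (concat Cs) \<or> flip y \<in> set (concat Cs)"
proof -
  have "chain L (Bs @ [])" using red by (simp add: reduced_def)
  note split = chain_split[OF this]
  have "y \<notin> set M" "flip y \<notin> set M" using split y unfolding LM[symmetric] consistent_def by auto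
  moreover have mem: "y \<in> set (shell L (concat Bs))" using y by (simp add: shell_def)
  ultimately show ?thesis using reduced_agree_variables[OF red(2) agree[symmetric] mem] by auto
qed

text \<open>One common letter \<open>x\<close> from the first block decides the orientation of the
  core. At the first cut of the second word \<open>x\<close> is \<open>F\<close> or
  \<open>C\<close>, which forces all letters of the first word that follow \<open>x\<close> to be
  \<open>F\<close>. A letter that occurred with the opposite sign in the second word would be
  \<open>E\<close> or \<open>C\<close>.\<close>
lemma aligned_core_letters:
  assumes red: "reduced s L (B # Bs)" "reduced s M Cs"
    and agree: "\<And>\<phi>. ev s \<phi> (shell L (concat (B # Bs))) = ev s \<phi> (shell M (concat Cs))"
    and LM: "set L = set M" and x: "x \<in> set B" "x \<in> set (concat Cs)"
  shows "set (concat (B # Bs)) = set (concat Cs)"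
proof
  show sub: "set (concat (B # Bs)) \<subseteq> set (concat Cs)"
  proof (rule subsetI, rule ccontr)
    fix y assume y: "y \<in> set (concat (B # Bs))" "y \<notin> set (concat Cs)"
    then have flip: "flip y \<in> set (concat Cs)" using core_letters[OF red agree LM] by blast
    obtain \<phi> where \<phi>: "ev s \<phi> (shell M (concat Cs)) \<noteq> Z" "\<forall>x\<in>set (concat Cs). val \<phi> x \<in> {F, C}"
      using reduced_bottom[OF red(2)] by blast
    have "x \<noteq> y" using x y by auto
    have "\<exists>p q t. concat (B # Bs) = p @ x # q @ y # t"
    proof (cases "y \<in> set B")
      case True
      have "block B" using red(1) by (simp add: reduced_def chain_def)
      from block_positions[OF this x(1) True \<open>x \<noteq> y\<close>]
      obtain p q t where "B = p @ x # q @ y # t" by blast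
      then have "concat (B # Bs) = p @ x # q @ y # (t @ concat Bs)" by simp
      then show ?thesis by blast
    next
      case False
      then have "y \<in> set (concat Bs)" using y(1) by simp
      from split_list[OF this] obtain c d where "concat Bs = c @ y # d" by blast
      moreover obtain a b where "B = a @ x # b" using split_list[OF x(1)] by blast
      ultimately have "concat (B # Bs) = a @ x # (b @ c) @ y # d" by simp
      then show ?thesis by blast
    qed
    then obtain p q t where pos: "concat (B # Bs) = p @ x # q @ y # t" by blast
    have "val \<phi> x \<in> {F, C}" using \<phi>(2) x(2) by blast
    then have "val \<phi> y = F" using shell_core_order[OF _ pos, of s \<phi> L] \<phi>(1) agree by metis
    moreover have "val \<phi> (flip y) \<in> {F, C}" using \<phi>(2) flip by blast
    ultimately show False by simp
  qed
  show "set (concat Cs) \<subseteq> set (concat (B # Bs))"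
  proof
    fix y assume y: "y \<in> set (concat Cs)"
    have "consistent (M @ concat Cs)" using red(2) by (simp add: reduced_def chain_def)
    then have "flip y \<notin> set (concat Cs)" using y by (auto simp: consistent_def)
    then show "y \<in> set (concat (B # Bs))"
      using core_letters[OF red(2,1) agree[symmetric] LM[symmetric] y] sub by blast
  qed
qed

lemma teq_ev: "teq s u v \<Longrightarrow> u \<noteq> [] \<Longrightarrow> ev s \<phi> u = ev s \<phi> v"
  using tri.short_weq_sound[of s u v] by (auto simp: holds_def satisfies_def wval_def)

text \<open>After reversing one of the cores if necessary, the two words have the same letters in
  shell and core, and the order and kind of their blocks agree.\<close>
lemma reduced_unique:
  assumes red: "reduced s L Bs" "reduced s M Cs"
    and agree: "\<And>\<phi>. ev s \<phi> (shell L (concat Bs)) = ev s \<phi> (shell M (concat Cs))"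
  shows "teq s (shell L (concat Bs)) (shell M (concat Cs))"
proof (cases "L = [] \<or> M = []")
  case True
  then have "L = []" "M = []"
    using plain_letters(1)[OF _ red(2)] plain_letters(1)[OF _ red(1)] red agree by metis+
  then show ?thesis
    using plain_letters(2)[OF red(1,2)[unfolded \<open>L = []\<close>]] plain_letters(2)[OF red(2,1)[unfolded \<open>M = []\<close>]] agree red
    by (intro reduced_unique_aligned) auto
next
  case False
  have LM: "set L = set M"
    using shell_letters[OF red agree] shell_letters[OF red(2,1) agree[symmetric]] by blast
  show ?thesis
  proof (cases Bs)
    case Nil
    then have "y \<notin> set (concat Cs)" for y
      using core_letters[OF red(2,1) agree[symmetric] LM[symmetric], of y] by auto
    then have "set (concat Cs) = {}" by (meson all_not_in_conv)
    then show ?thesis using Nil LM red agree by (intro reduced_unique_aligned) auto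
  next
    case (Cons B Bs')
    have "block B" using red(1) by (simp add: Cons reduced_def chain_def)
    then have "B \<noteq> []" by (rule block_nonempty)
    then obtain x where x: "x \<in> set B" using hd_in_set by blast
    then have "x \<in> set (concat Bs)" by (simp add: Cons)
    from core_letters[OF red agree LM this] show ?thesis
    proof
      assume "x \<in> set (concat Cs)"
      then have "set (concat Bs) = set (concat Cs)"
        using aligned_core_letters[of s L B Bs' M Cs x] red agree LM x by (simp add: Cons)
      then show ?thesis using LM by (intro reduced_unique_aligned[OF red agree])
    next
      assume "flip x \<in> set (concat Cs)"
      then have x': "x \<in> set (concat (reverse_core Cs))"
        unfolding concat_reverse_core by (simp add: in_flip_image)
      have red': "reduced s M (reverse_core Cs)" using red(2) False by (simp add: reduced_reverse)
      have rev: "teq s (shell M (concat Cs)) (shell M (concat (reverse_core Cs)))"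
        unfolding concat_reverse_core using False by (intro teq_reverse) simp
      have agree': "ev s \<phi> (shell L (concat Bs)) = ev s \<phi> (shell M (concat (reverse_core Cs)))" for \<phi>
      proof -
        have "shell M (concat Cs) \<noteq> []" using red(2) by (simp add: reduced_def reduced_nonempty)
        from teq_ev[OF rev this] show ?thesis using agree by metis
      qed
      have "set (concat Bs) = set (concat (reverse_core Cs))"
        using aligned_core_letters[of s L B Bs' M "reverse_core Cs" x] red(1) red' agree' LM x x'
        by (simp add: Cons)
      then have "teq s (shell L (concat Bs)) (shell M (concat (reverse_core Cs)))"
        using LM by (intro reduced_unique_aligned[OF red(1) red' agree'])
      then show ?thesis using rev by (meson weq_sym weq_trans)
    qed
  qed
qed

lemma tri_complete:
  assumes "holds UNIV (tmul s) tstar u v"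
  shows "teq s u v"
proof -
  have ne: "u \<noteq> []" "v \<noteq> []" using assms by (auto simp: holds_def)
  have agree: "ev s \<phi> u = ev s \<phi> v" for \<phi> using assms by (simp add: holds_def satisfies_def wval_def)
  have null: "ev s \<phi> w = Z" if "teq s w null_word" "w \<noteq> []" for w \<phi>
  proof -
    have "ev s \<phi> w = ev s \<phi> null_word" using that by (rule teq_ev)
    also have "\<dots> = Z" by (cases "\<phi> 0") (auto simp: wval_def)
    finally show ?thesis .
  qed
  have nonzero: "\<exists>\<phi>. ev s \<phi> w \<noteq> Z" if "teq s w (shell L (concat Bs))" "w \<noteq> []" "reduced s L Bs" for w L Bs
    using reduced_bottom[OF that(3)] teq_ev[OF that(1,2)] by metis
  consider "teq s u null_word" "teq s v null_word"
    | L Bs M Cs where "reduced s L Bs" "teq s u (shell L (concat Bs))"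
        "reduced s M Cs" "teq s v (shell M (concat Cs))"
    using reduced_cases[OF ne(1), of s] reduced_cases[OF ne(2), of s] null nonzero ne agree by metis
  then show ?thesis
  proof cases
    case 1
    then show ?thesis by (meson weq_sym weq_trans)
  next
    case 2
    have "teq s (shell L (concat Bs)) (shell M (concat Cs))"
      using agree teq_ev[OF 2(2) ne(1)] teq_ev[OF 2(4) ne(2)] by (intro reduced_unique 2(1,3)) simp
    then show ?thesis using 2(2,4) by (meson weq_sym weq_trans)
  qed
qed

theorem tri_finitely_based: "finitely_based UNIV (tmul s) tstar"
  by (intro tri.finitely_based_short tri_complete)

section \<open>Noncommutative involution semigroups of order four\<close>

definition cayley :: "('a \<Rightarrow> 'a \<Rightarrow> 'a) \<Rightarrow> 'a list \<Rightarrow> 'a list list" where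
  "cayley m xs = map (\<lambda>x. map (m x) xs) xs"

text \<open>In this order: the rectangular band, two nilpotent semigroups of class three, the
  triangular semigroup with \<open>E F = Z\<close>, the one with \<open>E F = C\<close> (in both
  \<open>E\<close>, \<open>F\<close>, \<open>C\<close>, \<open>Z\<close> are \<open>b\<close>,
  \<open>a\<close>, \<open>d\<close>, \<open>c\<close>), and the semigroup of \<open>side\<close>
  elements (with \<open>Lt\<close>, \<open>Rt\<close>, \<open>Id\<close>, \<open>Nl\<close> being
  \<open>a\<close>, \<open>b\<close>, \<open>d\<close>, \<open>c\<close>).\<close>
definition noncommutative_tables :: "'a \<Rightarrow> 'a \<Rightarrow> 'a \<Rightarrow> 'a \<Rightarrow> 'a list list set" where
  "noncommutative_tables a b c d =
    {[[a, c, c, a],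
      [d, b, b, d],
      [a, c, c, a],
      [d, b, b, d]],
     [[c, c, c, c],
      [d, c, c, c],
      [c, c, c, c],
      [c, c, c, c]],
     [[c, c, d, d],
      [d, c, d, d],
      [d, d, d, d],
      [d, d, d, d]],
     [[a, c, c, c],
      [c, b, c, d],
      [c, c, c, c],
      [d, c, c, c]],
     [[a, c, c, c],
      [d, b, c, d],
      [c, c, c, c],
      [d, c, c, c]],
     [[c, c, c, a],
      [c, c, c, c],
      [c, c, c, c],
      [c, b, c, d]]}"

text \<open>A finite search. The relabellings that preserve the star exchange \<open>a\<close> with
  \<open>b\<close> and \<open>c\<close> with \<open>d\<close>; each solution matches one of the six
  tables up to such exchanges.\<close>
lemma noncommutative_table_exhaust:
  assumes distinct: "distinct [a, b, c, d]"
    and inv: "involution_semigroup {a, b, c, d} m st"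
    and st: "st a = b" "st b = a" "st c = c" "st d = d"
    and nc: "\<exists>x\<in>{a, b, c, d}. \<exists>y\<in>{a, b, c, d}. m x y \<noteq> m y x"
  shows "cayley m [a, b, c, d] \<in> noncommutative_tables a b c d \<or>
    cayley m [b, a, c, d] \<in> noncommutative_tables b a c d \<or>
    cayley m [a, b, d, c] \<in> noncommutative_tables a b d c \<or>
    cayley m [b, a, d, c] \<in> noncommutative_tables b a d c"
proof -
  interpret involution_semigroup "{a, b, c, d}" m st by (rule inv)
  have closed: "\<forall>x\<in>{a, b, c, d}. \<forall>y\<in>{a, b, c, d}. m x y = a \<or> m x y = b \<or> m x y = c \<or> m x y = d"
    using mult_closed by blast
  have assoc: "\<forall>x\<in>{a, b, c, d}. \<forall>y\<in>{a, b, c, d}. \<forall>z\<in>{a, b, c, d}. m (m x y) z = m x (m y z)"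
    using mult_assoc by blast
  have star: "\<forall>x\<in>{a, b, c, d}. \<forall>y\<in>{a, b, c, d}. st (m x y) = m (st y) (st x)"
    using star_mult by blast
  have ball: "(\<forall>x\<in>{a, b, c, d}. P x) \<longleftrightarrow> P a \<and> P b \<and> P c \<and> P d" for P by blast
  have bex: "(\<exists>x\<in>{a, b, c, d}. P x) \<longleftrightarrow> P a \<or> P b \<or> P c \<or> P d" for P by blast
  have ne: "a \<noteq> b" "a \<noteq> c" "a \<noteq> d" "b \<noteq> c" "b \<noteq> d" "c \<noteq> d" using distinct by auto
  show ?thesis
    unfolding cayley_def noncommutative_tables_def list.map insert_iff empty_iff list.inject
    using closed[unfolded ball] assoc[unfolded ball] star[unfolded ball st] st ne nc[unfolded bex]
    by (smt (z3))
qed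

context involution_semigroup
begin

text \<open>A star that fixes every element makes the multiplication commutative, so some
  \<open>a\<close> differs from \<open>b = a\<^sup>*\<close>. The element \<open>ab\<close> is
  fixed, which leaves only one further element, and that must be fixed as well.\<close>
lemma fixed_and_swapped_elements:
  assumes card: "card S = 4" and nc: "\<exists>x\<in>S. \<exists>y\<in>S. mult x y \<noteq> mult y x"
  shows "\<exists>a b c d. S = {a, b, c, d} \<and> distinct [a, b, c, d] \<and>
    star a = b \<and> star b = a \<and> star c = c \<and> star d = d"
proof -
  obtain a where a: "a \<in> S" "star a \<noteq> a"
  proof -
    have "\<exists>a\<in>S. star a \<noteq> a"
    proof (rule ccontr)
      assume "\<not> ?thesis"
      then have "mult x y = mult y x" if "x \<in> S" "y \<in> S" for x y
        using that star_mult[OF that] mult_closed[OF that] by metis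
      then show False using nc by blast
    qed
    then show thesis using that by blast
  qed
  define b where "b = star a"
  define c where "c = mult a b"
  have b: "b \<in> S" "star b = a" using a by (auto simp: b_def star_closed star_star)
  have c: "c \<in> S" "star c = c" using a b by (auto simp: c_def mult_closed star_mult b_def[symmetric])
  have abc: "distinct [a, b, c]" using a b c b_def by auto
  then have "card {a, b, c} = 3" by simp
  moreover have fin: "finite S" using card by (simp add: card_ge_0_finite)
  ultimately have "card (S - {a, b, c}) = 1"
    using card a b c by (subst card_Diff_subset) auto
  then obtain d where d: "S - {a, b, c} = {d}" using card_1_singletonE by blast
  then have S: "S = {a, b, c, d}" using a b c by auto
  have dS: "d \<in> S" "d \<notin> {a, b, c}" using d by auto
  have "star d \<in> S" "star (star d) = d" using dS by (auto simp: star_closed star_star)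
  moreover have sa: "star a = b" by (simp add: b_def)
  ultimately have "star d \<noteq> a" "star d \<noteq> b" "star d \<noteq> c" using dS(2) b(2) c(2) by force+
  then have "star d = d" using \<open>star d \<in> S\<close> unfolding S by blast
  moreover have "distinct [a, b, c, d]" using abc dS(2) by auto
  ultimately show ?thesis using S sa b(2) c(2) by blast
qed

lemma noncommutative_table_finitely_based:
  assumes S: "S = {a, b, c, d}" and dist: "distinct [a, b, c, d]"
    and st: "star a = b" "star b = a" "star c = c" "star d = d"
    and table: "cayley mult [a, b, c, d] \<in> noncommutative_tables a b c d"
  shows "finitely_based S mult star"
proof -
  have ne: "a \<noteq> b" "a \<noteq> c" "a \<noteq> d" "b \<noteq> c" "b \<noteq> d" "c \<noteq> d"
    "b \<noteq> a" "c \<noteq> a" "d \<noteq> a" "c \<noteq> b" "d \<noteq> b" "d \<noteq> c" using dist by auto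
  have tri: "finitely_based S mult star"
    if "\<And>x y. case_tri b a d c (tmul s x y) = mult (case_tri b a d c x) (case_tri b a d c y)" for s
  proof (rule finitely_based_iso[where h = "case_tri b a d c", OF _ that _ tri_finitely_based])
    show "bij_betw (case_tri b a d c) UNIV S"
      unfolding bij_betw_def
    proof
      show "inj (case_tri b a d c)" using ne by (auto simp: inj_def split: tri.split)
      have all: "(UNIV :: tri set) = {E, F, C, Z}" using tri.exhaust by blast
      show "range (case_tri b a d c) = S" unfolding all S by auto
    qed
    show "case_tri b a d c (tstar x) = star (case_tri b a d c x)" for x using st by (cases x) auto
  qed
  have side: "finitely_based S mult star"
    if "\<And>x y. case_side a b d c (smul x y) = mult (case_side a b d c x) (case_side a b d c y)"
  proof (rule finitely_based_iso[where h = "case_side a b d c", OF _ that _ side_finitely_based])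
    show "bij_betw (case_side a b d c) UNIV S"
      unfolding bij_betw_def
    proof
      show "inj (case_side a b d c)" using ne by (auto simp: inj_def split: side.split)
      have all: "(UNIV :: side set) = {Lt, Rt, Id, Nl}" using side.exhaust by blast
      show "range (case_side a b d c) = S" unfolding all S by auto
    qed
    show "case_side a b d c (sstar x) = star (case_side a b d c x)" for x using st by (cases x) auto
  qed
  have nilpotent: "finitely_based S mult star" if "\<forall>x\<in>S. \<forall>y\<in>S. \<forall>z\<in>S. mult x (mult y z) = w" for w
    using that by (intro finitely_based_nilpotent) simp
  from table show ?thesis
    unfolding noncommutative_tables_def insert_iff empty_iff cayley_def list.map list.inject
  proof (elim disjE conjE FalseE)
    assume "mult a a = a" "mult a b = c" "mult a c = c" "mult a d = a"
      "mult b a = d" "mult b b = b" "mult b c = b" "mult b d = d"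
      "mult c a = a" "mult c b = c" "mult c c = c" "mult c d = a"
      "mult d a = d" "mult d b = b" "mult d c = b" "mult d d = d"
    then show ?thesis by (intro finitely_based_rectangular) (auto simp: S)
  next
    assume "mult a a = c" "mult a b = c" "mult a c = c" "mult a d = c"
      "mult b a = d" "mult b b = c" "mult b c = c" "mult b d = c"
      "mult c a = c" "mult c b = c" "mult c c = c" "mult c d = c"
      "mult d a = c" "mult d b = c" "mult d c = c" "mult d d = c"
    then show ?thesis by (intro nilpotent[of c]) (auto simp: S)
  next
    assume "mult a a = c" "mult a b = c" "mult a c = d" "mult a d = d"
      "mult b a = d" "mult b b = c" "mult b c = d" "mult b d = d"
      "mult c a = d" "mult c b = d" "mult c c = d" "mult c d = d"
      "mult d a = d" "mult d b = d" "mult d c = d" "mult d d = d"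
    then show ?thesis by (intro nilpotent[of d]) (auto simp: S)
  next
    assume eqs: "mult a a = a" "mult a b = c" "mult a c = c" "mult a d = c"
      "mult b a = c" "mult b b = b" "mult b c = c" "mult b d = d"
      "mult c a = c" "mult c b = c" "mult c c = c" "mult c d = c"
      "mult d a = d" "mult d b = c" "mult d c = c" "mult d d = c"
    show ?thesis
    proof (rule tri[of False])
      show "case_tri b a d c (tmul False x y) = mult (case_tri b a d c x) (case_tri b a d c y)" for x y
        by (cases x; cases y) (simp_all add: eqs)
    qed
  next
    assume eqs: "mult a a = a" "mult a b = c" "mult a c = c" "mult a d = c"
      "mult b a = d" "mult b b = b" "mult b c = c" "mult b d = d"
      "mult c a = c" "mult c b = c" "mult c c = c" "mult c d = c"
      "mult d a = d" "mult d b = c" "mult d c = c" "mult d d = c"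
    show ?thesis
    proof (rule tri[of True])
      show "case_tri b a d c (tmul True x y) = mult (case_tri b a d c x) (case_tri b a d c y)" for x y
        by (cases x; cases y) (simp_all add: eqs)
    qed
  next
    assume eqs: "mult a a = c" "mult a b = c" "mult a c = c" "mult a d = a"
      "mult b a = c" "mult b b = c" "mult b c = c" "mult b d = c"
      "mult c a = c" "mult c b = c" "mult c c = c" "mult c d = c"
      "mult d a = c" "mult d b = b" "mult d c = c" "mult d d = d"
    show ?thesis
    proof (rule side)
      show "case_side a b d c (smul x y) = mult (case_side a b d c x) (case_side a b d c y)" for x y
        by (cases x; cases y) (simp_all add: eqs)
    qed
  qed
qed

lemma noncommutative_order_four_finitely_based:
  assumes "card S = 4" and nc: "\<exists>x\<in>S. \<exists>y\<in>S. mult x y \<noteq> mult y x"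
  shows "finitely_based S mult star"
proof -
  obtain a b c d where S: "S = {a, b, c, d}" and dist: "distinct [a, b, c, d]"
    and st: "star a = b" "star b = a" "star c = c" "star d = d"
    using fixed_and_swapped_elements[OF assms] by blast
  have "involution_semigroup {a, b, c, d} mult star" using involution_semigroup_axioms S by simp
  from noncommutative_table_exhaust[OF dist this st nc[unfolded S]] show ?thesis
  proof (elim disjE)
    show ?thesis if "cayley mult [a, b, c, d] \<in> noncommutative_tables a b c d"
      by (rule noncommutative_table_finitely_based[OF S dist st that])
    show ?thesis if "cayley mult [b, a, c, d] \<in> noncommutative_tables b a c d"
      using dist st that by (intro noncommutative_table_finitely_based[of b a c d]) (auto simp: S)
    show ?thesis if "cayley mult [a, b, d, c] \<in> noncommutative_tables a b d c"
      using dist st that by (intro noncommutative_table_finitely_based[of a b d c]) (auto simp: S)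
    show ?thesis if "cayley mult [b, a, d, c] \<in> noncommutative_tables b a d c"
      using dist st that by (intro noncommutative_table_finitely_based[of b a d c]) (auto simp: S)
  qed
qed

end

theorem theorem1p1:
  fixes S :: "'a set"
    and mult :: "'a \<Rightarrow> 'a \<Rightarrow> 'a"
    and star :: "'a \<Rightarrow> 'a"
  assumes "involution_semigroup S mult star"
    and "card S = 4"
  shows "finitely_based S mult star"
proof -
  interpret involution_semigroup S mult star by (rule assms(1))
  have "finite S" using assms(2) by (simp add: card_ge_0_finite)
  then show ?thesis
    using finite_commutative_finitely_based noncommutative_order_four_finitely_based assms(2) by blast
qed

end
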